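(* Let $I$ be a totally ordered set and let $J,K$ be disjoint nonempty subsets of $I$ such that $I=J\cup K$ and every element of $J$ is smaller than every element of $K$. Let $\{(\mathcal A_i,\varphi_i,\psi_i,\theta_i)\}_{i\in I}$ be a family of unital 3-algebraic probability spaces. Then, under the natural identification $\ast_{i\in I}\mathcal A_i\simeq(\ast_{j\in J}\mathcal A_j)\ast(\ast_{k\in K}\mathcal A_k)$, $$\leftthreetimes_{i\in I}(\mathcal A_i,\varphi_i,\psi_i,\theta_i)=\Big(\leftthreetimes_{j\in J}(\mathcal A_j,\varphi_j,\psi_j,\theta_j)\Big)\leftthreetimes\Big(\leftthreetimes_{k\in K}(\mathcal A_k,\varphi_k,\psi_k,\theta_k)\Big).$$
   Context: All algebras are associative over $\mathbb C$. A unital 3-algebraic probability space is a tuple $(\mathcal A,\varphi,\psi,\theta)$ of a unital algebra and three unital linear functionals on it. $\ast_{i\in I}\mathcal A_i$ denotes the unital free product (coproduct of unital algebras); each $\mathcal A_i$ is regarded as a subalgebra of it. For a totally ordered set $I$, $I^\ast$ is the set of finite sequences $\mathbf i=(i_1,\dots,i_n)$, $n\ge1$, of elements of $I$ with $i_k\ne i_{k+1}$ for all $1\le k\le n-1$. Put $\mathrm{Peak}(\mathbf i)=\{k\in\{2,\dots,n-1\}: i_{k-1}<i_k>i_{k+1}\}$ and $\mathrm{Bot}(\mathbf i)=\{k\in\{2,\dots,n-1\}: i_{k-1}>i_k<i_{k+1}\}$. Given unital 3-algebraic probability spaces $(\mathcal A_i,\varphi_i,\psi_i,\theta_i)$, $i\in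 I$, define linear functionals $\alpha_{\mathbf i,k}$ on $\mathcal A_{i_k}$ by $\alpha_{\mathbf i,1}=\varphi_{i_1}$, $\alpha_{\mathbf i,k}=\psi_{i_k}$ if $k\in\mathrm{Peak}(\mathbf i)$, $\alpha_{\mathbf i,k}=\theta_{i_k}$ if $k\in\mathrm{Bot}(\mathbf i)$, and $\alpha_{\mathbf i,k}=0$ otherwise. Let $\beta_{\mathbf i,k}$ (resp. $\gamma_{\mathbf i,k}$) be defined in the same way with $\varphi_{i_1}$ replaced by $\psi_{i_1}$ (resp. $\theta_{i_1}$). The $\alpha$-free product $\leftthreetimes_{i\in I}(\mathcal A_i,\varphi_i,\psi_i,\theta_i)$ is the (unique, existing) tuple $(\mathcal A,\varphi,\psi,\theta)$, where $\mathcal A=\ast_{i\in I}\mathcal A_i$ and $\varphi,\psi,\theta$ are unital linear functionals on $\mathcal A$ such that for every $\mathbf i=(i_1,\dots,i_n)\in I^\ast$ and $a_k\in\mathcal A_{i_k}$: $\varphi(a_1\cdots a_n)=0$ whenever $a_k\in\ker\alpha_{\mathbf i,k}$ for all $k$; $\psi(a_1\cdots a_n)=0$ whenever $a_k\in\ker\beta_{\mathbf i,k}$ for all $k$; $\theta(a_1\cdots a_n)=0$ whenever $a_k\in\ker\gamma_{\mathbf i,k}$ for all $k$. For a one-element index set the product is the given space itself. The binary operation $\leftthreetimes$ is the $\alpha$-free product over the index set $\{1,2\}$ with $1<2$, the left factor having index $1$. *)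

theory Defs
  imports Complex_Main "HOL-Algebra.QuotRing" "HOL-Algebra.Module"
begin

section \<open>Unital complex algebras\<close>

definition complex_ring :: "complex ring" where
  "complex_ring = \<lparr>carrier = UNIV, mult = (*), one = 1, zero = 0, add = (+)\<rparr>"

text \<open>The library locale \<^locale>\<open>algebra\<close> is restricted to commutative algebras.\<close>

locale complex_algebra = module complex_ring A + ring A for A (structure) +
  assumes smult_assoc_left:
      "\<lbrakk>x \<in> carrier A; y \<in> carrier A\<rbrakk> \<Longrightarrow> (c \<odot> x) \<otimes> y = c \<odot> (x \<otimes> y)"
    and smult_assoc_right:
      "\<lbrakk>x \<in> carrier A; y \<in> carrier A\<rbrakk> \<Longrightarrow> x \<otimes> (c \<odot> y) = c \<odot> (x \<otimes> y)"

definition algebra_hom ::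
  "(complex, 'a, 'm) module_scheme \<Rightarrow> (complex, 'b, 'n) module_scheme \<Rightarrow> ('a \<Rightarrow> 'b) set" where
  "algebra_hom A B = {h \<in> ring_hom A B. \<forall>c. \<forall>x\<in>carrier A. h (c \<odot>\<^bsub>A\<^esub> x) = c \<odot>\<^bsub>B\<^esub> h x}"

definition algebra_iso ::
  "(complex, 'a, 'm) module_scheme \<Rightarrow> (complex, 'b, 'n) module_scheme \<Rightarrow> ('a \<Rightarrow> 'b) set" where
  "algebra_iso A B = {h \<in> algebra_hom A B. bij_betw h (carrier A) (carrier B)}"

definition unital_functional :: "(complex, 'a, 'm) module_scheme \<Rightarrow> ('a \<Rightarrow> complex) \<Rightarrow> bool" where
  "unital_functional A f \<longleftrightarrow>
     (\<forall>x\<in>carrier A. \<forall>y\<in>carrier A. f (x \<oplus>\<^bsub>A\<^esub> y) = f x + f y) \<and>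
     (\<forall>c. \<forall>x\<in>carrier A. f (c \<odot>\<^bsub>A\<^esub> x) = c * f x) \<and>
     f \<one>\<^bsub>A\<^esub> = 1"


section \<open>The free product (coproduct) of unital algebras\<close>

text \<open>The free unital algebra on a set \<open>X\<close>: finitely supported functions on the words over
  \<open>X\<close>, multiplied by convolution over all factorisations of a word.\<close>

definition free_algebra :: "'x set \<Rightarrow> (complex, 'x list \<Rightarrow> complex) module" where
  "free_algebra X =
     \<lparr>carrier = {f. finite {w. f w \<noteq> 0} \<and> {w. f w \<noteq> 0} \<subseteq> lists X},
      mult = (\<lambda>f g w. \<Sum>k\<le>length w. f (take k w) * g (drop k w)),
      one = (\<lambda>w. if w = [] then 1 else 0),
      zero = (\<lambda>w. 0),
      add = (\<lambda>f g w. f w + g w),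
      smult = (\<lambda>c f w. c * f w)\<rparr>"

definition free_var :: "'x \<Rightarrow> 'x list \<Rightarrow> complex" where
  "free_var x = (\<lambda>w. if w = [x] then 1 else 0)"

definition quotient_algebra ::
  "(complex, 'a, 'm) module_scheme \<Rightarrow> 'a set \<Rightarrow> (complex, 'a set) module" where
  "quotient_algebra A N =
     \<lparr>carrier = carrier (A Quot N), mult = mult (A Quot N), one = one (A Quot N),
      zero = zero (A Quot N), add = add (A Quot N),
      smult = (\<lambda>c S. \<Union>x\<in>S. N +>\<^bsub>A\<^esub> (c \<odot>\<^bsub>A\<^esub> x))\<rparr>"

text \<open>The free product of \<open>A i\<close>, \<open>i \<in> I\<close>, is presented by one generator \<open>(i, a)\<close> for each
  \<open>a \<in> A i\<close>, subject to exactly the relations that make \<open>a \<mapsto> (i, a)\<close> a homomorphism of unital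
  algebras for each \<open>i\<close>.\<close>

definition free_product_gens :: "'i set \<Rightarrow> ('i \<Rightarrow> (complex, 'a) module) \<Rightarrow> ('i \<times> 'a) set" where
  "free_product_gens I A = (SIGMA i:I. carrier (A i))"

definition free_product_rels ::
  "'i set \<Rightarrow> ('i \<Rightarrow> (complex, 'a) module) \<Rightarrow> (('i \<times> 'a) list \<Rightarrow> complex) set" where
  "free_product_rels I A =
     (let F = free_algebra (free_product_gens I A) in
        {free_var (i, a \<oplus>\<^bsub>A i\<^esub> b) \<ominus>\<^bsub>F\<^esub> (free_var (i, a) \<oplus>\<^bsub>F\<^esub> free_var (i, b)) |i a b.
           i \<in> I \<and> a \<in> carrier (A i) \<and> b \<in> carrier (A i)} \<union>
        {free_var (i, c \<odot>\<^bsub>A i\<^esub> a) \<ominus>\<^bsub>F\<^esub> (c \<odot>\<^bsub>F\<^esub> free_var (i, a)) |i c a.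
           i \<in> I \<and> a \<in> carrier (A i)} \<union>
        {free_var (i, a \<otimes>\<^bsub>A i\<^esub> b) \<ominus>\<^bsub>F\<^esub> (free_var (i, a) \<otimes>\<^bsub>F\<^esub> free_var (i, b)) |i a b.
           i \<in> I \<and> a \<in> carrier (A i) \<and> b \<in> carrier (A i)} \<union>
        {free_var (i, \<one>\<^bsub>A i\<^esub>) \<ominus>\<^bsub>F\<^esub> \<one>\<^bsub>F\<^esub> |i. i \<in> I})"

definition free_product_ideal ::
  "'i set \<Rightarrow> ('i \<Rightarrow> (complex, 'a) module) \<Rightarrow> (('i \<times> 'a) list \<Rightarrow> complex) set" where
  "free_product_ideal I A =
     Idl\<^bsub>free_algebra (free_product_gens I A)\<^esub> (free_product_rels I A)"

definition free_product ::
  "'i set \<Rightarrow> ('i \<Rightarrow> (complex, 'a) module) \<Rightarrow> (complex, (('i \<times> 'a) list \<Rightarrow> complex) set) module" where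
  "free_product I A =
     quotient_algebra (free_algebra (free_product_gens I A)) (free_product_ideal I A)"

definition free_product_inc ::
  "'i set \<Rightarrow> ('i \<Rightarrow> (complex, 'a) module) \<Rightarrow> 'i \<Rightarrow> 'a \<Rightarrow> (('i \<times> 'a) list \<Rightarrow> complex) set" where
  "free_product_inc I A i a =
     free_product_ideal I A +>\<^bsub>free_algebra (free_product_gens I A)\<^esub> free_var (i, a)"

text \<open>The product \<open>a 0 \<cdots> a (n-1)\<close> in the free product, where \<open>a k\<close> lies in \<open>A (is ! k)\<close>
  and \<open>n = length is\<close>.\<close>

definition word_product ::
  "'i set \<Rightarrow> ('i \<Rightarrow> (complex, 'a) module) \<Rightarrow> 'i list \<Rightarrow> (nat \<Rightarrow> 'a)
    \<Rightarrow> (('i \<times> 'a) list \<Rightarrow> complex) set" where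
  "word_product I A is a =
     foldr (mult (free_product I A))
       (map (\<lambda>k. free_product_inc I A (is ! k) (a k)) [0..<length is])
       \<one>\<^bsub>free_product I A\<^esub>"

text \<open>The natural identification of the free product over \<open>J \<union> K\<close> with the free product of the
  free products over \<open>J\<close> and over \<open>K\<close>. These conditions determine \<open>h\<close> uniquely on the carrier,
  which is generated by the images of the \<open>A i\<close>.\<close>

definition pair_family :: "'b \<Rightarrow> 'b \<Rightarrow> nat \<Rightarrow> 'b" where
  "pair_family x y = (\<lambda>i. if i = 1 then x else y)"

definition natural_identification ::
  "'i set \<Rightarrow> 'i set \<Rightarrow> ('i \<Rightarrow> (complex, 'a) module) \<Rightarrow>
   ((('i \<times> 'a) list \<Rightarrow> complex) set \<Rightarrow>
    ((nat \<times> (('i \<times> 'a) list \<Rightarrow> complex) set) list \<Rightarrow> complex) set) \<Rightarrow> bool" where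
  "natural_identification J K A h \<longleftrightarrow>
     (let AA = pair_family (free_product J A) (free_product K A) in
        h \<in> algebra_iso (free_product (J \<union> K) A) (free_product {1, 2} AA) \<and>
        (\<forall>j\<in>J. \<forall>a\<in>carrier (A j). h (free_product_inc (J \<union> K) A j a) =
           free_product_inc {1, 2} AA 1 (free_product_inc J A j a)) \<and>
        (\<forall>k\<in>K. \<forall>a\<in>carrier (A k). h (free_product_inc (J \<union> K) A k a) =
           free_product_inc {1, 2} AA 2 (free_product_inc K A k a)))"


section \<open>Unital 3-algebraic probability spaces\<close>

record 'a prob_space3 =
  alg :: "(complex, 'a) module"
  phi :: "'a \<Rightarrow> complex"
  psi :: "'a \<Rightarrow> complex"
  theta :: "'a \<Rightarrow> complex"

definition unital_prob_space3 :: "'a prob_space3 \<Rightarrow> bool" where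
  "unital_prob_space3 S \<longleftrightarrow> complex_algebra (alg S) \<and>
     unital_functional (alg S) (phi S) \<and>
     unital_functional (alg S) (psi S) \<and>
     unital_functional (alg S) (theta S)"

text \<open>Equality of two spaces up to an identification \<open>h\<close> of their algebras.\<close>

definition equal_under :: "('a \<Rightarrow> 'b) \<Rightarrow> 'a prob_space3 \<Rightarrow> 'b prob_space3 \<Rightarrow> bool" where
  "equal_under h S T \<longleftrightarrow> h \<in> algebra_iso (alg S) (alg T) \<and>
     (\<forall>x\<in>carrier (alg S).
        phi S x = phi T (h x) \<and> psi S x = psi T (h x) \<and> theta S x = theta T (h x))"


section \<open>The alpha-free product\<close>

definition alternating :: "'i set \<Rightarrow> 'i list set" where
  "alternating I = {is. is \<noteq> [] \<and> set is \<subseteq> I \<and> distinct_adj is}"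

text \<open>Positions in a word are counted from \<open>0\<close>.\<close>

definition Peak :: "'i::linorder list \<Rightarrow> nat set" where
  "Peak is = {k. 0 < k \<and> k + 1 < length is \<and> is ! (k - 1) < is ! k \<and> is ! k > is ! (k + 1)}"

definition Bot :: "'i::linorder list \<Rightarrow> nat set" where
  "Bot is = {k. 0 < k \<and> k + 1 < length is \<and> is ! (k - 1) > is ! k \<and> is ! k < is ! (k + 1)}"

text \<open>For \<open>\<chi> = phi\<close>, \<open>psi\<close>, \<open>theta\<close> this is the functional \<open>\<alpha>\<close>, \<open>\<beta>\<close>, \<open>\<gamma>\<close>, respectively, attached
  to the position \<open>k\<close> of the index word \<open>is\<close>.\<close>

definition position_functional ::
  "('a prob_space3 \<Rightarrow> 'a \<Rightarrow> complex) \<Rightarrow> ('i::linorder \<Rightarrow> 'a prob_space3)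
    \<Rightarrow> 'i list \<Rightarrow> nat \<Rightarrow> 'a \<Rightarrow> complex" where
  "position_functional \<chi> P is k =
     (if k = 0 then \<chi> (P (is ! k))
      else if k \<in> Peak is then psi (P (is ! k))
      else if k \<in> Bot is then theta (P (is ! k))
      else (\<lambda>_. 0))"

definition vanishes_on_kernels ::
  "('a prob_space3 \<Rightarrow> 'a \<Rightarrow> complex) \<Rightarrow> 'i::linorder set \<Rightarrow> ('i \<Rightarrow> 'a prob_space3)
    \<Rightarrow> ((('i \<times> 'a) list \<Rightarrow> complex) set \<Rightarrow> complex) \<Rightarrow> bool" where
  "vanishes_on_kernels \<chi> I P f \<longleftrightarrow>
     (\<forall>is\<in>alternating I. \<forall>a.
        (\<forall>k<length is. a k \<in> carrier (alg (P (is ! k))) \<and> position_functional \<chi> P is k (a k) = 0)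
        \<longrightarrow> f (word_product I (\<lambda>i. alg (P i)) is a) = 0)"

text \<open>The functionals are required to be \<^const>\<open>extensional\<close>, i.e. to have a fixed value outside
  the carrier, so that they are determined by their values on the carrier.\<close>

definition is_alpha_free_product ::
  "'i::linorder set \<Rightarrow> ('i \<Rightarrow> 'a prob_space3) \<Rightarrow> (('i \<times> 'a) list \<Rightarrow> complex) set prob_space3 \<Rightarrow> bool"
  where
  "is_alpha_free_product I P Q \<longleftrightarrow>
     alg Q = free_product I (\<lambda>i. alg (P i)) \<and>
     (\<forall>f\<in>{phi Q, psi Q, theta Q}.
        f \<in> extensional (carrier (alg Q)) \<and> unital_functional (alg Q) f) \<and>
     vanishes_on_kernels phi I P (phi Q) \<and>
     vanishes_on_kernels psi I P (psi Q) \<and>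
     vanishes_on_kernels theta I P (theta Q)"

definition alpha_free_product ::
  "'i::linorder set \<Rightarrow> ('i \<Rightarrow> 'a prob_space3) \<Rightarrow> (('i \<times> 'a) list \<Rightarrow> complex) set prob_space3" where
  "alpha_free_product I P = (THE Q. is_alpha_free_product I P Q)"

definition alpha_free_times ::
  "'a prob_space3 \<Rightarrow> 'a prob_space3 \<Rightarrow> ((nat \<times> 'a) list \<Rightarrow> complex) set prob_space3" where
  "alpha_free_times S T = alpha_free_product {1, 2} (pair_family S T)"

end

theory Submission
  imports Defs
begin

text \<open>
  Read a word of the free product from left to right while keeping a stack of letters with distinct
  adjacent indices. A new letter is merged with the top of the stack if both have the same index;
  the result \<open>b\<close> is then split as \<open>c 1 + (b - c 1)\<close>, where \<open>c\<close> is its value under \<open>psi\<close> if the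
  index is larger than that of the letter below it, under \<open>theta\<close> if it is smaller, and under the
  given base functional at the bottom of the stack. The value of the word is the total weight with
  which the stack ends up empty. This weight is multilinear and respects the relations of the free
  product, so it defines a functional on it. Words all of whose letters are centered for the
  functionals just named (\<open>stack_ok\<close>) have value \<open>0\<close>, and this determines a unital functional;
  the kernel conditions defining the alpha-free product ask for the same, since a letter at a
  monotone position may be centered at will: what remains after deleting it has the same peaks and
  bottoms.

  Associativity follows by cutting a centered word into maximal blocks over \<open>J\<close> and over \<open>K\<close>: the
  blocks are centered elements of the two factors, so the iterated product vanishes on such words
  as well.
\<close>

section \<open>Complex algebras and linear maps\<close>

text \<open>Peaks and bottoms depend on the right neighbour, so a letter cannot be centered for its
  position functional before the next letter is known. The functional used on the stack depends only
  on the letter below, which makes a left-to-right evaluation possible; the price is that its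
  agreement with the kernel conditions has to be shown in both directions
  (\<open>vanishes_on_stacks\<close>, \<open>ev_kernels\<close>). Since
  \<open>alpha_free_product\<close> is a definite description, existence and uniqueness must be
  settled before anything can be said about it. The evaluation serves both: it constructs a
  functional, and it computes every unital functional that vanishes on centered words. The three
  functionals cannot be separated. Whatever functional opens the word, a later block over
  \<open>K\<close> behaves like a word evaluated by \<open>psi\<close> and a later block over
  \<open>J\<close> like one evaluated by \<open>theta\<close>, so even the
  \<open>phi\<close>-component of the iterated product rests on the other two components of the
  factors.\<close>

lemma complex_ring_simps [simp]:
  "carrier complex_ring = UNIV" "mult complex_ring = (*)" "one complex_ring = 1"
  "zero complex_ring = 0" "add complex_ring = (+)"
  by (simp_all add: complex_ring_def)

lemma cring_complex_ring: "cring complex_ring"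
proof (rule cringI)
  show "abelian_group complex_ring"
    by (rule abelian_groupI) (auto simp: algebra_simps intro: exI[of _ "- _"] left_minus)
  show "Group.comm_monoid complex_ring"
    by (rule comm_monoidI) auto
qed (auto simp: algebra_simps)

lemma complex_algebraI:
  fixes A (structure)
  assumes "ring A"
    and "\<And>c x. x \<in> carrier A \<Longrightarrow> c \<odot> x \<in> carrier A"
    and "\<And>c d x. x \<in> carrier A \<Longrightarrow> (c + d) \<odot> x = c \<odot> x \<oplus> d \<odot> x"
    and "\<And>c x y. \<lbrakk>x \<in> carrier A; y \<in> carrier A\<rbrakk> \<Longrightarrow> c \<odot> (x \<oplus> y) = c \<odot> x \<oplus> c \<odot> y"
    and "\<And>c d x. x \<in> carrier A \<Longrightarrow> (c * d) \<odot> x = c \<odot> (d \<odot> x)"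
    and "\<And>x. x \<in> carrier A \<Longrightarrow> 1 \<odot> x = x"
    and "\<And>c x y. \<lbrakk>x \<in> carrier A; y \<in> carrier A\<rbrakk> \<Longrightarrow> (c \<odot> x) \<otimes> y = c \<odot> (x \<otimes> y)"
    and "\<And>c x y. \<lbrakk>x \<in> carrier A; y \<in> carrier A\<rbrakk> \<Longrightarrow> x \<otimes> (c \<odot> y) = c \<odot> (x \<otimes> y)"
  shows "complex_algebra A"
proof -
  have "module complex_ring A"
    by (rule moduleI) (use assms cring_complex_ring ring.is_abelian_group in auto)
  then show ?thesis
    using assms by (simp add: complex_algebra_def complex_algebra_axioms_def)
qed

text \<open>The library rules are phrased with the operations of \<open>complex_ring\<close>;
  restated with complex arithmetic they can be used for rewriting in either direction.\<close>

lemma complex_module_rules: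
  assumes "module complex_ring M" "x \<in> carrier M"
  shows "(c + d) \<odot>\<^bsub>M\<^esub> x = c \<odot>\<^bsub>M\<^esub> x \<oplus>\<^bsub>M\<^esub> d \<odot>\<^bsub>M\<^esub> x"
    and "(c * d) \<odot>\<^bsub>M\<^esub> x = c \<odot>\<^bsub>M\<^esub> (d \<odot>\<^bsub>M\<^esub> x)"
    and "1 \<odot>\<^bsub>M\<^esub> x = x"
    and "0 \<odot>\<^bsub>M\<^esub> x = \<zero>\<^bsub>M\<^esub>"
  using assms module.smult_l_distr[of complex_ring M c d x] module.smult_assoc1[of complex_ring M c d x]
    module.smult_one[of complex_ring M x] module.smult_l_null[of complex_ring M x] by simp_all

text \<open>The scalars as a module over themselves. With this target a functional is a linear map,
  so one extension theorem serves both functionals and algebra homomorphisms.\<close>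

definition complex_module :: "(complex, complex) module" where
  "complex_module = \<lparr>carrier = UNIV, mult = (*), one = 1, zero = 0, add = (+), smult = (*)\<rparr>"

lemma complex_module_simps [simp]:
  "carrier complex_module = UNIV" "zero complex_module = 0" "add complex_module = (+)"
  "smult complex_module = (*)"
  by (simp_all add: complex_module_def)

lemma module_complex_module: "module complex_ring complex_module"
proof (rule moduleI)
  show "abelian_group complex_module"
    by (rule abelian_groupI) (auto simp: algebra_simps intro: exI[of _ "- _"] left_minus)
qed (auto simp: cring_complex_ring algebra_simps)

definition linear_maps ::
  "(complex, 'a, 'm) module_scheme \<Rightarrow> (complex, 'b, 'n) module_scheme \<Rightarrow> ('a \<Rightarrow> 'b) set" where
  "linear_maps M N = {f. (\<forall>x\<in>carrier M. f x \<in> carrier N) \<and>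
     (\<forall>x\<in>carrier M. \<forall>y\<in>carrier M. f (x \<oplus>\<^bsub>M\<^esub> y) = f x \<oplus>\<^bsub>N\<^esub> f y) \<and>
     (\<forall>c. \<forall>x\<in>carrier M. f (c \<odot>\<^bsub>M\<^esub> x) = c \<odot>\<^bsub>N\<^esub> f x)}"

lemma linear_mapsD:
  assumes "f \<in> linear_maps M N"
  shows "\<And>x. x \<in> carrier M \<Longrightarrow> f x \<in> carrier N"
    and "\<And>x y. x \<in> carrier M \<Longrightarrow> y \<in> carrier M \<Longrightarrow> f (x \<oplus>\<^bsub>M\<^esub> y) = f x \<oplus>\<^bsub>N\<^esub> f y"
    and "\<And>c x. x \<in> carrier M \<Longrightarrow> f (c \<odot>\<^bsub>M\<^esub> x) = c \<odot>\<^bsub>N\<^esub> f x"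
  using assms by (auto simp: linear_maps_def)

lemma linear_map_zero:
  assumes "f \<in> linear_maps M N" "module complex_ring M" "module complex_ring N"
  shows "f \<zero>\<^bsub>M\<^esub> = \<zero>\<^bsub>N\<^esub>"
proof -
  interpret M: module complex_ring M by fact
  interpret N: module complex_ring N by fact
  have "f \<zero>\<^bsub>M\<^esub> = f (0 \<odot>\<^bsub>M\<^esub> \<zero>\<^bsub>M\<^esub>)"
    using M.smult_r_null by simp
  also have "\<dots> = 0 \<odot>\<^bsub>N\<^esub> f \<zero>\<^bsub>M\<^esub>"
    using linear_mapsD(3)[OF assms(1)] M.M.zero_closed by blast
  also have "\<dots> = \<zero>\<^bsub>N\<^esub>"
    using N.smult_l_null linear_mapsD(1)[OF assms(1)] by simp
  finally show ?thesis .
qed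

lemma linear_map_minus:
  assumes "f \<in> linear_maps M N" "module complex_ring M" "module complex_ring N" "x \<in> carrier M"
  shows "f (\<ominus>\<^bsub>M\<^esub> x) = \<ominus>\<^bsub>N\<^esub> f x"
proof -
  interpret M: module complex_ring M by fact
  interpret N: module complex_ring N by fact
  have "f (\<ominus>\<^bsub>M\<^esub> x) \<oplus>\<^bsub>N\<^esub> f x = f (\<ominus>\<^bsub>M\<^esub> x \<oplus>\<^bsub>M\<^esub> x)"
    using assms by (simp add: linear_mapsD(2)[OF assms(1)])
  also have "\<dots> = \<zero>\<^bsub>N\<^esub>"
    using assms by (simp add: M.M.l_neg linear_map_zero)
  finally show ?thesis
    using assms by (simp add: linear_mapsD(1)[OF assms(1)] N.minus_equality)
qed

lemma linear_map_diff:
  assumes L: "L \<in> linear_maps M N" and "module complex_ring M" "module complex_ring N"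
    and "x \<in> carrier M" "y \<in> carrier M"
  shows "L (x \<ominus>\<^bsub>M\<^esub> y) = L x \<ominus>\<^bsub>N\<^esub> L y"
proof -
  interpret M: module complex_ring M by fact
  show ?thesis
    using assms(2-) by (simp add: a_minus_def linear_mapsD[OF L] linear_map_minus[OF L])
qed

lemma unital_functional_iff_linear:
  "unital_functional A f \<longleftrightarrow> f \<in> linear_maps A complex_module \<and> f \<one>\<^bsub>A\<^esub> = 1"
  by (auto simp: unital_functional_def linear_maps_def)

lemma algebra_homD:
  assumes "h \<in> algebra_hom A B"
  shows "\<And>x. x \<in> carrier A \<Longrightarrow> h x \<in> carrier B"
    and "\<And>x y. x \<in> carrier A \<Longrightarrow> y \<in> carrier A \<Longrightarrow> h (x \<oplus>\<^bsub>A\<^esub> y) = h x \<oplus>\<^bsub>B\<^esub> h y"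
    and "\<And>x y. x \<in> carrier A \<Longrightarrow> y \<in> carrier A \<Longrightarrow> h (x \<otimes>\<^bsub>A\<^esub> y) = h x \<otimes>\<^bsub>B\<^esub> h y"
    and "\<And>c x. x \<in> carrier A \<Longrightarrow> h (c \<odot>\<^bsub>A\<^esub> x) = c \<odot>\<^bsub>B\<^esub> h x"
    and "h \<one>\<^bsub>A\<^esub> = \<one>\<^bsub>B\<^esub>"
  using assms by (auto simp: algebra_hom_def ring_hom_def)

lemma algebra_homI:
  assumes "\<And>x. x \<in> carrier A \<Longrightarrow> h x \<in> carrier B"
    and "\<And>x y. x \<in> carrier A \<Longrightarrow> y \<in> carrier A \<Longrightarrow> h (x \<oplus>\<^bsub>A\<^esub> y) = h x \<oplus>\<^bsub>B\<^esub> h y"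
    and "\<And>x y. x \<in> carrier A \<Longrightarrow> y \<in> carrier A \<Longrightarrow> h (x \<otimes>\<^bsub>A\<^esub> y) = h x \<otimes>\<^bsub>B\<^esub> h y"
    and "\<And>c x. x \<in> carrier A \<Longrightarrow> h (c \<odot>\<^bsub>A\<^esub> x) = c \<odot>\<^bsub>B\<^esub> h x"
    and "h \<one>\<^bsub>A\<^esub> = \<one>\<^bsub>B\<^esub>"
  shows "h \<in> algebra_hom A B"
  using assms by (auto simp: algebra_hom_def ring_hom_def)

lemma algebra_hom_linear: "h \<in> algebra_hom A B \<Longrightarrow> h \<in> linear_maps A B"
  by (auto simp: linear_maps_def algebra_homD)

lemma algebra_hom_compose:
  "g \<in> algebra_hom A B \<Longrightarrow> h \<in> algebra_hom B C \<Longrightarrow> (\<lambda>x. h (g x)) \<in> algebra_hom A C"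
  by (rule algebra_homI) (auto simp: algebra_homD)

lemma linear_maps_compose:
  "g \<in> linear_maps A B \<Longrightarrow> h \<in> linear_maps B C \<Longrightarrow> (\<lambda>x. h (g x)) \<in> linear_maps A C"
  by (auto simp: linear_maps_def)

section \<open>The free algebra\<close>

definition monomial :: "'x list \<Rightarrow> 'x list \<Rightarrow> complex" where
  "monomial u = (\<lambda>w. if w = u then 1 else 0)"

definition convolve :: "('x list \<Rightarrow> complex) \<Rightarrow> ('x list \<Rightarrow> complex) \<Rightarrow> 'x list \<Rightarrow> complex" where
  "convolve f g = (\<lambda>w. \<Sum>k\<le>length w. f (take k w) * g (drop k w))"

lemma free_algebra_simps:
  "carrier (free_algebra X) = {f. finite {w. f w \<noteq> 0} \<and> {w. f w \<noteq> 0} \<subseteq> lists X}"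
  "mult (free_algebra X) = convolve"
  "one (free_algebra X) = monomial []"
  "zero (free_algebra X) = (\<lambda>w. 0)"
  "add (free_algebra X) = (\<lambda>f g w. f w + g w)"
  "smult (free_algebra X) = (\<lambda>c f w. c * f w)"
  by (simp_all add: free_algebra_def convolve_def[abs_def] monomial_def)

lemma free_var_eq_monomial: "free_var x = monomial [x]"
  by (simp add: free_var_def monomial_def)

lemma convolve_Nil [simp]: "convolve f g [] = f [] * g []"
  by (simp add: convolve_def)

text \<open>The cut before the first letter is split off; every other cut divides the tail, with the
  first letter absorbed into \<open>f\<close>. This recursion replaces the reindexing of double
  sums.\<close>

lemma convolve_Cons [simp]:
  "convolve f g (x # w) = f [] * g (x # w) + convolve (\<lambda>v. f (x # v)) g w"
  unfolding convolve_def by (simp add: sum.atMost_Suc_shift del: sum.atMost_Suc)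

lemma convolve_add_left: "convolve (\<lambda>w. f w + g w) h w = convolve f h w + convolve g h w"
  by (simp add: convolve_def sum.distrib algebra_simps)

lemma convolve_add_right: "convolve h (\<lambda>w. f w + g w) w = convolve h f w + convolve h g w"
  by (simp add: convolve_def sum.distrib algebra_simps)

lemma convolve_smult_left: "convolve (\<lambda>w. c * f w) h w = c * convolve f h w"
  by (simp add: convolve_def sum_distrib_left algebra_simps)

lemma convolve_smult_right: "convolve h (\<lambda>w. c * f w) w = c * convolve h f w"
  by (simp add: convolve_def sum_distrib_left algebra_simps)

lemma convolve_zero_left: "convolve (\<lambda>w. 0) h w = 0"
  by (simp add: convolve_def)

text \<open>The induction on the word needs \<open>f\<close> arbitrary, because each step replaces
  \<open>f\<close> by its shift past the first letter.\<close>

lemma convolve_assoc: "convolve (convolve f g) h w = convolve f (convolve g h) w"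
proof (induction w arbitrary: f)
  case Nil
  then show ?case by simp
next
  case (Cons x w)
  then show ?case
    by (simp add: convolve_add_left convolve_smult_left algebra_simps)
qed

lemma convolve_one_left: "convolve (monomial []) g w = g w"
  by (cases w) (simp_all add: monomial_def convolve_zero_left)

lemma convolve_one_right: "convolve f (monomial []) w = f w"
  by (induction w arbitrary: f) (simp_all add: monomial_def)

lemma convolve_monomials: "convolve (monomial u) (monomial v) = monomial (u @ v)"
proof
  show "convolve (monomial u) (monomial v) w = monomial (u @ v) w" for w
  proof (induction u arbitrary: w)
    case Nil
    then show ?case by (simp add: convolve_one_left)
  next
    case (Cons x u)
    have "(\<lambda>t. monomial (x # u) (y # t)) = (\<lambda>t. (if y = x then 1 else 0) * monomial u t)" for y
      by (auto simp: monomial_def)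
    then show ?case
      by (cases w) (auto simp: convolve_smult_left Cons.IH, auto simp: monomial_def)
  qed
qed

context
  notes free_algebra_simps [simp]
begin

lemma convolve_closed:
  assumes "f \<in> carrier (free_algebra X)" "g \<in> carrier (free_algebra X)"
  shows "convolve f g \<in> carrier (free_algebra X)"
proof -
  have *: "\<exists>u v. w = u @ v \<and> f u \<noteq> 0 \<and> g v \<noteq> 0" if "convolve f g w \<noteq> 0" for w
  proof -
    obtain k where "f (take k w) * g (drop k w) \<noteq> 0"
    proof (rule ccontr)
      assume "\<not> thesis"
      then have "f (take k w) * g (drop k w) = 0" for k
        using that by blast
      then have "convolve f g w = 0"
        unfolding convolve_def by (intro sum.neutral) blast
      with \<open>convolve f g w \<noteq> 0\<close> show False by blast
    qed
    then have "w = take k w @ drop k w \<and> f (take k w) \<noteq> 0 \<and> g (drop k w) \<noteq> 0"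
      by auto
    then show ?thesis by blast
  qed
  then have "{w. convolve f g w \<noteq> 0} \<subseteq> (\<lambda>(u, v). u @ v) ` ({w. f w \<noteq> 0} \<times> {w. g w \<noteq> 0})"
    by (force simp: image_iff)
  then have "finite {w. convolve f g w \<noteq> 0}"
    using assms by (auto intro: finite_subset)
  moreover have "{w. convolve f g w \<noteq> 0} \<subseteq> lists X"
    using * assms by (fastforce simp: subset_iff)
  ultimately show ?thesis by simp
qed

lemma complex_algebra_free_algebra: "complex_algebra (free_algebra X)"
proof (rule complex_algebraI)
  have add: "(\<lambda>w. f w + g w) \<in> carrier (free_algebra X)"
    if "f \<in> carrier (free_algebra X)" "g \<in> carrier (free_algebra X)" for f g
  proof -
    have "{w. f w + g w \<noteq> 0} \<subseteq> {w. f w \<noteq> 0} \<union> {w. g w \<noteq> 0}" by auto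
    with that show ?thesis by (auto intro: finite_subset)
  qed
  have smult: "(\<lambda>w. c * f w) \<in> carrier (free_algebra X)"
    if "f \<in> carrier (free_algebra X)" for c f
  proof -
    have "{w. c * f w \<noteq> 0} \<subseteq> {w. f w \<noteq> 0}" by auto
    with that show ?thesis by (auto intro: finite_subset)
  qed
  show "ring (free_algebra X)"
  proof (rule ringI)
    show "abelian_group (free_algebra X)"
    proof (rule abelian_groupI)
      fix f assume f: "f \<in> carrier (free_algebra X)"
      then show "\<exists>g\<in>carrier (free_algebra X). g \<oplus>\<^bsub>free_algebra X\<^esub> f = \<zero>\<^bsub>free_algebra X\<^esub>"
        using smult[OF f, of "- 1"] by (intro bexI[of _ "\<lambda>w. - f w"]) auto
    qed (use add in \<open>auto simp: algebra_simps\<close>)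
    show "Group.monoid (free_algebra X)"
    proof (rule monoidI)
      show "\<one>\<^bsub>free_algebra X\<^esub> \<in> carrier (free_algebra X)"
        by (auto simp: monomial_def)
    qed (use convolve_closed[of _ X] in
        \<open>auto simp: fun_eq_iff convolve_assoc convolve_one_left convolve_one_right\<close>)
  qed (auto simp: convolve_add_left convolve_add_right)
  show "c \<odot>\<^bsub>free_algebra X\<^esub> f \<in> carrier (free_algebra X)"
    if "f \<in> carrier (free_algebra X)" for c f
    using smult[OF that] by simp
qed (auto simp: fun_eq_iff algebra_simps convolve_smult_left convolve_smult_right)

lemma monomial_closed [simp]:
  "monomial w \<in> carrier (free_algebra X) \<longleftrightarrow> w \<in> lists X"
  by (auto simp: monomial_def)

text \<open>The induction runs over a finite set containing the support instead of the support
  itself, so it does not matter which of the remaining coefficients vanish.\<close>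

lemma free_algebra_induct [consumes 1, case_names zero add]:
  assumes "f \<in> carrier (free_algebra X)"
    and zero: "P \<zero>\<^bsub>free_algebra X\<^esub>"
    and add: "\<And>g c w. \<lbrakk>g \<in> carrier (free_algebra X); w \<in> lists X; P g\<rbrakk> \<Longrightarrow>
      P (g \<oplus>\<^bsub>free_algebra X\<^esub> c \<odot>\<^bsub>free_algebra X\<^esub> monomial w)"
  shows "P f"
proof -
  have "P f" if "finite S" "S \<subseteq> lists X" "{w. f w \<noteq> 0} \<subseteq> S" for S f
    using that
  proof (induction arbitrary: f)
    case empty
    then have "f = (\<lambda>w. 0)" by auto
    then show ?case using zero by simp
  next
    case (insert w S)
    let ?g = "\<lambda>v. if v = w then 0 else f v"
    have sub: "{v. ?g v \<noteq> 0} \<subseteq> S" using insert by auto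
    have "?g \<in> carrier (free_algebra X)"
      using sub insert by (auto intro: finite_subset)
    then have "P (?g \<oplus>\<^bsub>free_algebra X\<^esub> f w \<odot>\<^bsub>free_algebra X\<^esub> monomial w)"
      using insert sub by (intro add) auto
    moreover have "?g \<oplus>\<^bsub>free_algebra X\<^esub> f w \<odot>\<^bsub>free_algebra X\<^esub> monomial w = f"
      by (auto simp: monomial_def)
    ultimately show ?case by simp
  qed
  with assms(1) show ?thesis by auto
qed

end

lemma free_algebra_linear_extension:
  fixes M (structure)
  assumes "module complex_ring M" and e: "\<And>w. w \<in> lists X \<Longrightarrow> e w \<in> carrier M"
  obtains L where "L \<in> linear_maps (free_algebra X) M"
    and "\<And>w. w \<in> lists X \<Longrightarrow> L (monomial w) = e w"
proof -
  interpret module complex_ring M by fact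
  note free_algebra_simps [simp]
  have eW: "e w \<in> carrier M" if "w \<in> W" "W \<subseteq> lists X" for w W
    using that by (intro e) blast
  define L where "L f = (\<Oplus>w\<in>{w. f w \<noteq> 0}. f w \<odot> e w)" for f
  \<comment> \<open>The defining sum runs over the support, which changes under addition and
    scaling; any larger finite set may be used instead, and this gives two elements a common index
    set.\<close>
  have L_eq: "L f = (\<Oplus>w\<in>W. f w \<odot> e w)" if "finite W" "{w. f w \<noteq> 0} \<subseteq> W" "W \<subseteq> lists X" for f W
    unfolding L_def
  proof (rule M.add.finprod_mono_neutral_cong_left)
    show "f w \<odot> e w = \<zero>" if "w \<in> W - {w. f w \<noteq> 0}" for w
      using that \<open>W \<subseteq> lists X\<close> smult_l_null[OF e, of w] by auto
    show "(\<lambda>w. f w \<odot> e w) \<in> W \<rightarrow> carrier M"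
      using \<open>W \<subseteq> lists X\<close> e by (intro Pi_I smult_closed e) (simp, blast)
  qed (use that in auto)
  show ?thesis
  proof
    show "L (monomial w) = e w" if "w \<in> lists X" for w
    proof -
      have "L (monomial w) = (\<Oplus>v\<in>{w}. monomial w v \<odot> e v)"
        using that by (intro L_eq) (auto simp: monomial_def)
      also have "\<dots> = monomial w w \<odot> e w \<oplus> \<zero>"
        using e[OF that] by (subst M.finsum_insert) auto
      also have "\<dots> = e w"
        using e[OF that] smult_one by (simp add: monomial_def)
      finally show ?thesis .
    qed
    have "L f \<in> carrier M" if "f \<in> carrier (free_algebra X)" for f
      unfolding L_def using that by (intro M.finsum_closed Pi_I smult_closed eW) auto
    moreover have "L (\<lambda>w. f w + g w) = L f \<oplus> L g"
      if "f \<in> carrier (free_algebra X)" "g \<in> carrier (free_algebra X)" for f g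
    proof -
      let ?W = "{w. f w \<noteq> 0} \<union> {w. g w \<noteq> 0}"
      have W: "finite ?W" "?W \<subseteq> lists X" "{w. f w + g w \<noteq> 0} \<subseteq> ?W"
        using that by auto
      have "L (\<lambda>w. f w + g w) = (\<Oplus>w\<in>?W. f w \<odot> e w \<oplus> g w \<odot> e w)"
        unfolding L_eq[OF W(1,3,2)]
        using W smult_l_distr eW[OF _ W(2)] by (intro M.finsum_cong) (auto simp: simp_implies_def Pi_def)
      also have "\<dots> = L f \<oplus> L g"
        using W eW[OF _ W(2)] by (subst M.finsum_addf) (auto simp: L_eq[OF W(1) _ W(2)] Pi_def)
      finally show ?thesis .
    qed
    moreover have "L (\<lambda>w. c * f w) = c \<odot> L f" if "f \<in> carrier (free_algebra X)" for c f
    proof -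
      let ?W = "{w. f w \<noteq> 0}"
      have W: "finite ?W" "?W \<subseteq> lists X" "{w. c * f w \<noteq> 0} \<subseteq> ?W"
        using that by auto
      have "L (\<lambda>w. c * f w) = (\<Oplus>w\<in>?W. c \<odot> (f w \<odot> e w))"
        unfolding L_eq[OF W(1,3,2)]
        using W smult_assoc1 eW[OF _ W(2)] by (intro M.finsum_cong) (auto simp: simp_implies_def Pi_def)
      also have "\<dots> = c \<odot> L f"
        using W eW[OF _ W(2)] by (subst finsum_smult_ldistr[symmetric]) (auto simp: L_def Pi_def)
      finally show ?thesis .
    qed
    ultimately show "L \<in> linear_maps (free_algebra X) M"
      by (simp add: linear_maps_def)
  qed
qed

section \<open>Quotient algebras\<close>

text \<open>\<open>quotient_algebra\<close> copies the operations of the factor ring into another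
  record, so the ring laws have to be carried over field by field.\<close>

lemma ring_cong:
  assumes "ring R" "carrier S = carrier R" "mult S = mult R" "one S = one R"
    "zero S = zero R" "add S = add R"
  shows "ring S"
proof -
  interpret ring R by fact
  show ?thesis
  proof (rule ringI)
    show "abelian_group S"
      by (rule abelian_groupI) (use assms abelian_groupE[OF is_abelian_group] in auto)
    show "Group.monoid S"
      by (rule monoidI) (use assms m_assoc in auto)
  qed (use assms l_distr r_distr in auto)
qed

text \<open>This set is the largest two-sided ideal inside the kernel of \<open>L\<close>. To see
  that \<open>L\<close> annihilates an ideal given by generators, it is then enough to test the
  generators between arbitrary factors \<open>g\<close> and \<open>h\<close>.\<close>

lemma linear_annihilator_ideal:
  assumes A: "complex_algebra A" and M: "module complex_ring M" and L: "L \<in> linear_maps A M"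
  shows "ideal {x \<in> carrier A. \<forall>g\<in>carrier A. \<forall>h\<in>carrier A.
    L (g \<otimes>\<^bsub>A\<^esub> x \<otimes>\<^bsub>A\<^esub> h) = \<zero>\<^bsub>M\<^esub>} A" (is "ideal ?K A")
proof -
  interpret A: complex_algebra A by fact
  interpret A: ring A by (rule A.ring_axioms)
  interpret M: module complex_ring M by fact
  note zero = linear_map_zero[OF L A.module_axioms M]
  note minus = linear_map_minus[OF L A.module_axioms M]
  show ?thesis
  proof (rule idealI)
    show "subgroup ?K (add_monoid A)"
    proof (rule A.add.subgroupI)
      show "?K \<noteq> {}" using zero by (auto intro!: exI[of _ "\<zero>\<^bsub>A\<^esub>"])
      show "\<ominus>\<^bsub>A\<^esub> x \<in> ?K" if "x \<in> ?K" for x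
        using that minus by (auto simp: A.l_minus A.r_minus)
      show "x \<oplus>\<^bsub>A\<^esub> y \<in> ?K" if "x \<in> ?K" "y \<in> ?K" for x y
        using that by (auto simp: A.l_distr A.r_distr linear_mapsD[OF L])
    qed auto
    show "y \<otimes>\<^bsub>A\<^esub> x \<in> ?K" if "x \<in> ?K" "y \<in> carrier A" for x y
    proof -
      have "g \<otimes>\<^bsub>A\<^esub> (y \<otimes>\<^bsub>A\<^esub> x) \<otimes>\<^bsub>A\<^esub> h = (g \<otimes>\<^bsub>A\<^esub> y) \<otimes>\<^bsub>A\<^esub> x \<otimes>\<^bsub>A\<^esub> h"
        if "g \<in> carrier A" "h \<in> carrier A" for g h
        using \<open>x \<in> ?K\<close> \<open>y \<in> carrier A\<close> that by (simp add: A.m_assoc)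
      with that show ?thesis by simp
    qed
    show "x \<otimes>\<^bsub>A\<^esub> y \<in> ?K" if "x \<in> ?K" "y \<in> carrier A" for x y
    proof -
      have "g \<otimes>\<^bsub>A\<^esub> (x \<otimes>\<^bsub>A\<^esub> y) \<otimes>\<^bsub>A\<^esub> h = g \<otimes>\<^bsub>A\<^esub> x \<otimes>\<^bsub>A\<^esub> (y \<otimes>\<^bsub>A\<^esub> h)"
        if "g \<in> carrier A" "h \<in> carrier A" for g h
        using \<open>x \<in> ?K\<close> \<open>y \<in> carrier A\<close> that by (simp add: A.m_assoc)
      with that show ?thesis by simp
    qed
  qed (rule A.ring_axioms)
qed

locale quotient_by_ideal = A: complex_algebra A + N: ideal N A
  for A :: "(complex, 'a, 'm) module_scheme" and N
begin

abbreviation Q where "Q \<equiv> quotient_algebra A N"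
abbreviation proj where "proj x \<equiv> N +>\<^bsub>A\<^esub> x"

lemma proj_eq_iff:
  assumes "x \<in> carrier A" "y \<in> carrier A"
  shows "proj x = proj y \<longleftrightarrow> x \<ominus>\<^bsub>A\<^esub> y \<in> N"
  using A.quotient_eq_iff_same_a_r_cos[OF N.ideal_axioms] assms by simp

lemma carrier_quotient: "carrier Q = proj ` carrier A"
  by (auto simp: quotient_algebra_def FactRing_def A_RCOSETS_def' a_r_coset_def')

lemma quotient_ops:
  assumes "x \<in> carrier A" "y \<in> carrier A"
  shows "proj x \<oplus>\<^bsub>Q\<^esub> proj y = proj (x \<oplus>\<^bsub>A\<^esub> y)"
    and "proj x \<otimes>\<^bsub>Q\<^esub> proj y = proj (x \<otimes>\<^bsub>A\<^esub> y)"
  using assms N.a_rcos_sum N.rcoset_mult_add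
  by (simp_all add: quotient_algebra_def FactRing_def)

lemma one_quotient: "\<one>\<^bsub>Q\<^esub> = proj \<one>\<^bsub>A\<^esub>"
  by (simp add: quotient_algebra_def FactRing_def)

lemma zero_quotient: "\<zero>\<^bsub>Q\<^esub> = proj \<zero>\<^bsub>A\<^esub>"
  by (simp add: quotient_algebra_def FactRing_def N.a_subset)

text \<open>Scaling by \<open>c\<close> is multiplication by \<open>c\<close> times the unit, so a
  ring ideal is automatically a subspace.\<close>

lemma smult_ideal: "x \<in> N \<Longrightarrow> c \<odot>\<^bsub>A\<^esub> x \<in> N"
proof -
  assume x: "x \<in> N"
  then have "x \<in> carrier A" by (rule N.a_Hcarr)
  then have "c \<odot>\<^bsub>A\<^esub> x = (c \<odot>\<^bsub>A\<^esub> \<one>\<^bsub>A\<^esub>) \<otimes>\<^bsub>A\<^esub> x"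
    by (simp add: A.smult_assoc_left)
  then show ?thesis using x N.I_l_closed[OF x, of "c \<odot>\<^bsub>A\<^esub> \<one>\<^bsub>A\<^esub>"] by simp
qed

lemma smult_quotient:
  assumes x: "x \<in> carrier A"
  shows "c \<odot>\<^bsub>Q\<^esub> proj x = proj (c \<odot>\<^bsub>A\<^esub> x)"
proof -
  have eq: "proj (c \<odot>\<^bsub>A\<^esub> y) = proj (c \<odot>\<^bsub>A\<^esub> x)" if y: "y \<in> proj x" for y
  proof -
    have "y \<in> carrier A"
      by (rule N.a_elemrcos_carrier[OF x y])
    moreover have "proj y = proj x"
      by (rule A.a_repr_independence[OF y x N.a_subgroup, symmetric])
    ultimately     have "y \<ominus>\<^bsub>A\<^esub> x \<in> N"
      using x by (simp add: proj_eq_iff)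
    then have "c \<odot>\<^bsub>A\<^esub> (y \<ominus>\<^bsub>A\<^esub> x) \<in> N" by (rule smult_ideal)
    moreover have "c \<odot>\<^bsub>A\<^esub> (y \<ominus>\<^bsub>A\<^esub> x) = c \<odot>\<^bsub>A\<^esub> y \<ominus>\<^bsub>A\<^esub> c \<odot>\<^bsub>A\<^esub> x"
      using x \<open>y \<in> carrier A\<close> A.smult_r_distr[of c y "\<ominus>\<^bsub>A\<^esub> x"] A.smult_r_minus[of c x]
      unfolding a_minus_def by simp
    ultimately show ?thesis
      using x \<open>y \<in> carrier A\<close> by (simp add: proj_eq_iff)
  qed
  \<comment> \<open>The union in the definition is taken over equal cosets and hence is a single
    coset.\<close>
  have "c \<odot>\<^bsub>Q\<^esub> proj x = (\<Union>y\<in>proj x. proj (c \<odot>\<^bsub>A\<^esub> y))"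
    by (simp add: quotient_algebra_def)
  also have "\<dots> = proj (c \<odot>\<^bsub>A\<^esub> x)"
    using eq N.a_rcos_self[OF x] by blast
  finally show ?thesis .
qed

lemma complex_algebra_quotient: "complex_algebra Q"
proof (rule complex_algebraI)
  show "ring Q"
    by (rule ring_cong[OF N.quotient_is_ring]) (simp_all add: quotient_algebra_def)
qed (auto simp: carrier_quotient smult_quotient quotient_ops A.smult_r_distr
      complex_module_rules[OF A.module_axioms] A.smult_assoc_left A.smult_assoc_right)

lemma proj_hom: "proj \<in> algebra_hom A Q"
  by (rule algebra_homI) (auto simp: carrier_quotient smult_quotient quotient_ops one_quotient)

lemma quotient_linear_map:
  assumes L: "L \<in> linear_maps A M" and M: "module complex_ring M"
    and N: "\<And>x. x \<in> N \<Longrightarrow> L x = \<zero>\<^bsub>M\<^esub>"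
  obtains L' where "L' \<in> linear_maps Q M" "\<And>x. x \<in> carrier A \<Longrightarrow> L' (proj x) = L x"
proof
  interpret M: module complex_ring M by fact
  define L' where "L' C = L (SOME x. x \<in> carrier A \<and> C = proj x)" for C
  show L': "L' (proj x) = L x" if x: "x \<in> carrier A" for x
  proof -
    define y where "y = (SOME y. y \<in> carrier A \<and> proj x = proj y)"
    have y: "y \<in> carrier A" "proj x = proj y"
      unfolding y_def by (rule someI2[of _ x]; use x in blast)+
    then have "L (y \<ominus>\<^bsub>A\<^esub> x) = \<zero>\<^bsub>M\<^esub>"
      using N x by (metis proj_eq_iff)
    then have "L y \<ominus>\<^bsub>M\<^esub> L x = \<zero>\<^bsub>M\<^esub>"
      using x y by (simp add: a_minus_def linear_mapsD[OF L] linear_map_minus[OF L A.module_axioms M])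
    then have "L y = L x"
      using x y M.minus_equality[of "L y" "\<ominus>\<^bsub>M\<^esub> L x"] linear_mapsD(1)[OF L]
      by (simp add: a_minus_def)
    then show ?thesis by (simp add: L'_def y_def)
  qed
  show "L' \<in> linear_maps Q M"
    by (auto simp: linear_maps_def carrier_quotient quotient_ops smult_quotient L' linear_mapsD[OF L])
qed

end

section \<open>Products of finite lists in a ring\<close>

definition list_prod :: "('a, 'm) ring_scheme \<Rightarrow> 'a list \<Rightarrow> 'a" where
  "list_prod R xs = foldr (mult R) xs (one R)"

lemma list_prod_simps [simp]:
  "list_prod R [] = \<one>\<^bsub>R\<^esub>" "list_prod R (x # xs) = x \<otimes>\<^bsub>R\<^esub> list_prod R xs"
  by (simp_all add: list_prod_def)

context ring
begin

lemma list_prod_closed: "set xs \<subseteq> carrier R \<Longrightarrow> list_prod R xs \<in> carrier R"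
  by (induction xs) auto

lemma list_prod_append:
  "set xs \<subseteq> carrier R \<Longrightarrow> set ys \<subseteq> carrier R \<Longrightarrow>
    list_prod R (xs @ ys) = list_prod R xs \<otimes> list_prod R ys"
  by (induction xs) (auto simp: list_prod_closed m_assoc)

end

section \<open>The free product\<close>

lemma monomial_mult:
  "monomial u \<otimes>\<^bsub>free_algebra X\<^esub> monomial v = monomial (u @ v)"
  by (simp add: free_algebra_simps convolve_monomials)

locale algebra_family =
  fixes I :: "'i set" and A :: "'i \<Rightarrow> (complex, 'a) module"
  assumes algebra: "i \<in> I \<Longrightarrow> complex_algebra (A i)"
begin

abbreviation "X \<equiv> free_product_gens I A"
abbreviation "F \<equiv> free_algebra X"
abbreviation "N \<equiv> free_product_ideal I A"
abbreviation "FP \<equiv> free_product I A"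
abbreviation "inc \<equiv> free_product_inc I A"

definition letter :: "'i \<times> 'a \<Rightarrow> (('i \<times> 'a) list \<Rightarrow> complex) set" where
  "letter x = inc (fst x) (snd x)"

text \<open>Each letter carries its index, unlike in \<open>word_product\<close>: the inductions run
  over a single list of pairs.\<close>

definition word :: "('i \<times> 'a) list \<Rightarrow> (('i \<times> 'a) list \<Rightarrow> complex) set" where
  "word w = list_prod FP (map letter w)"

lemma gens_iff [simp]: "(i, a) \<in> X \<longleftrightarrow> i \<in> I \<and> a \<in> carrier (A i)"
  by (simp add: free_product_gens_def)

lemma free_var_closed: "x \<in> X \<Longrightarrow> free_var x \<in> carrier F"
  by (simp add: free_var_eq_monomial)

lemma family_closed:
  assumes "i \<in> I"
  shows "a \<in> carrier (A i) \<Longrightarrow> b \<in> carrier (A i) \<Longrightarrow> a \<oplus>\<^bsub>A i\<^esub> b \<in> carrier (A i)"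
    and "a \<in> carrier (A i) \<Longrightarrow> b \<in> carrier (A i) \<Longrightarrow> a \<otimes>\<^bsub>A i\<^esub> b \<in> carrier (A i)"
    and "a \<in> carrier (A i) \<Longrightarrow> c \<odot>\<^bsub>A i\<^esub> a \<in> carrier (A i)"
    and "\<one>\<^bsub>A i\<^esub> \<in> carrier (A i)"
    and "\<zero>\<^bsub>A i\<^esub> \<in> carrier (A i)"
proof -
  interpret complex_algebra "A i" using assms by (rule algebra)
  interpret ring "A i" by (rule ring_axioms)
  show "a \<in> carrier (A i) \<Longrightarrow> b \<in> carrier (A i) \<Longrightarrow> a \<oplus>\<^bsub>A i\<^esub> b \<in> carrier (A i)"
    "a \<in> carrier (A i) \<Longrightarrow> b \<in> carrier (A i) \<Longrightarrow> a \<otimes>\<^bsub>A i\<^esub> b \<in> carrier (A i)"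
    "a \<in> carrier (A i) \<Longrightarrow> c \<odot>\<^bsub>A i\<^esub> a \<in> carrier (A i)"
    "\<one>\<^bsub>A i\<^esub> \<in> carrier (A i)" "\<zero>\<^bsub>A i\<^esub> \<in> carrier (A i)"
    by simp_all
qed

lemma free_algebra: "complex_algebra F"
  by (rule complex_algebra_free_algebra)

lemma rels_closed: "free_product_rels I A \<subseteq> carrier F"
proof -
  interpret F: complex_algebra F by (rule free_algebra)
  show ?thesis
    by (auto simp: free_product_rels_def Let_def
        intro!: F.minus_closed F.M.a_closed F.smult_closed F.m_closed free_var_closed family_closed)
qed

lemma quotient: "quotient_by_ideal F N"
proof -
  interpret F: complex_algebra F by (rule free_algebra)
  have "ideal N F"
    unfolding free_product_ideal_def by (rule F.genideal_ideal[OF rels_closed])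
  then show ?thesis
    by (simp add: quotient_by_ideal_def free_algebra)
qed

lemma complex_algebra_free_product: "complex_algebra FP"
  unfolding free_product_def by (rule quotient_by_ideal.complex_algebra_quotient[OF quotient])

lemma inc_eq: "inc i a = N +>\<^bsub>F\<^esub> free_var (i, a)"
  by (simp add: free_product_inc_def)

text \<open>For each homomorphism law, the difference of the two sides is one of the generating
  relations.\<close>

lemma inc_hom:
  assumes i: "i \<in> I"
  shows "inc i \<in> algebra_hom (A i) FP"
proof -
  interpret Q: quotient_by_ideal F N by (rule quotient)
  interpret Ai: complex_algebra "A i" using i by (rule algebra)
  have FP: "FP = quotient_algebra F N" by (simp add: free_product_def)
  have rels: "free_product_rels I A \<subseteq> N"
    unfolding free_product_ideal_def by (rule Q.A.genideal_self[OF rels_closed])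
  have eq: "Q.proj x = Q.proj y"
    if "x \<ominus>\<^bsub>F\<^esub> y \<in> free_product_rels I A" "x \<in> carrier F" "y \<in> carrier F" for x y
    using that rels by (auto simp: Q.proj_eq_iff)
  note [simp] = i free_var_closed family_closed[OF i]
  show ?thesis
    unfolding FP
  proof (rule algebra_homI)
    show "inc i x \<in> carrier (quotient_algebra F N)" if "x \<in> carrier (A i)" for x
      using that by (simp add: inc_eq Q.carrier_quotient)
    show "inc i (x \<oplus>\<^bsub>A i\<^esub> y) = inc i x \<oplus>\<^bsub>quotient_algebra F N\<^esub> inc i y"
      if "x \<in> carrier (A i)" "y \<in> carrier (A i)" for x y
    proof -
      have "free_var (i, x \<oplus>\<^bsub>A i\<^esub> y) \<ominus>\<^bsub>F\<^esub> (free_var (i, x) \<oplus>\<^bsub>F\<^esub> free_var (i, y)) \<in> free_product_rels I A"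
        unfolding free_product_rels_def Let_def using i that by blast
      from eq[OF this] show ?thesis
        using that by (simp add: inc_eq Q.quotient_ops)
    qed
    show "inc i (x \<otimes>\<^bsub>A i\<^esub> y) = inc i x \<otimes>\<^bsub>quotient_algebra F N\<^esub> inc i y"
      if "x \<in> carrier (A i)" "y \<in> carrier (A i)" for x y
    proof -
      have "free_var (i, x \<otimes>\<^bsub>A i\<^esub> y) \<ominus>\<^bsub>F\<^esub> (free_var (i, x) \<otimes>\<^bsub>F\<^esub> free_var (i, y)) \<in> free_product_rels I A"
        unfolding free_product_rels_def Let_def using i that by blast
      from eq[OF this] show ?thesis
        using that by (simp add: inc_eq Q.quotient_ops)
    qed
    show "inc i (c \<odot>\<^bsub>A i\<^esub> x) = c \<odot>\<^bsub>quotient_algebra F N\<^esub> inc i x"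
      if "x \<in> carrier (A i)" for c x
    proof -
      have "free_var (i, c \<odot>\<^bsub>A i\<^esub> x) \<ominus>\<^bsub>F\<^esub> (c \<odot>\<^bsub>F\<^esub> free_var (i, x)) \<in> free_product_rels I A"
        unfolding free_product_rels_def Let_def using i that by blast
      from eq[OF this] show ?thesis
        using that by (simp add: inc_eq Q.smult_quotient)
    qed
    show "inc i \<one>\<^bsub>A i\<^esub> = \<one>\<^bsub>quotient_algebra F N\<^esub>"
    proof -
      have "free_var (i, \<one>\<^bsub>A i\<^esub>) \<ominus>\<^bsub>F\<^esub> \<one>\<^bsub>F\<^esub> \<in> free_product_rels I A"
        unfolding free_product_rels_def Let_def using i by blast
      from eq[OF this] show ?thesis
        by (simp add: inc_eq Q.one_quotient)
    qed
  qed
qed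

lemma letter_closed: "x \<in> X \<Longrightarrow> letter x \<in> carrier FP"
  by (cases x) (auto simp: letter_def algebra_homD(1)[OF inc_hom])

lemma letters_closed: "w \<in> lists X \<Longrightarrow> set (map letter w) \<subseteq> carrier FP"
  by (auto simp: letter_closed)

lemma free_product_ring: "ring FP"
  using complex_algebra_free_product by (simp add: complex_algebra_def)

lemma free_product_module: "module complex_ring FP"
  using complex_algebra_free_product by (simp add: complex_algebra_def)

lemma word_closed: "w \<in> lists X \<Longrightarrow> word w \<in> carrier FP"
  unfolding word_def by (intro ring.list_prod_closed free_product_ring letters_closed)

lemma word_append:
  "u \<in> lists X \<Longrightarrow> v \<in> lists X \<Longrightarrow> word (u @ v) = word u \<otimes>\<^bsub>FP\<^esub> word v"
  unfolding word_def map_append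
  by (intro ring.list_prod_append free_product_ring letters_closed)

lemma word_Nil [simp]: "word [] = \<one>\<^bsub>FP\<^esub>"
  by (simp add: word_def)

lemma word_Cons: "word (x # w) = letter x \<otimes>\<^bsub>FP\<^esub> word w"
  by (simp add: word_def)

lemma word_singleton: "x \<in> X \<Longrightarrow> word [x] = letter x"
  using monoid.r_one[OF ring.is_monoid[OF free_product_ring]] letter_closed by (simp add: word_def)

text \<open>Monomials become words in the quotient, so the words span the free product; the
  induction and uniqueness principles below rest on this.\<close>

lemma proj_monomial:
  assumes "w \<in> lists X"
  shows "N +>\<^bsub>F\<^esub> monomial w = word w"
proof -
  interpret Q: quotient_by_ideal F N by (rule quotient)
  have FP: "FP = quotient_algebra F N" by (simp add: free_product_def)
  show ?thesis
    using assms
  proof (induction w)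
    case Nil
    then show ?case by (simp add: FP Q.one_quotient free_algebra_simps)
  next
    case (Cons x w)
    then show ?case
      using Q.quotient_ops(2)[of "monomial [x]" "monomial w"]
      by (simp add: word_Cons letter_def inc_eq FP free_var_eq_monomial monomial_mult)
  qed
qed

lemma free_product_induct [consumes 1, case_names zero add]:
  assumes "x \<in> carrier FP"
    and zero: "P \<zero>\<^bsub>FP\<^esub>"
    and add: "\<And>g c w. \<lbrakk>g \<in> carrier FP; w \<in> lists X; P g\<rbrakk> \<Longrightarrow> P (g \<oplus>\<^bsub>FP\<^esub> c \<odot>\<^bsub>FP\<^esub> word w)"
  shows "P x"
proof -
  interpret Q: quotient_by_ideal F N by (rule quotient)
  have FP: "FP = quotient_algebra F N" by (simp add: free_product_def)
  obtain f where f: "f \<in> carrier F" and x: "x = Q.proj f"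
    using assms(1) by (auto simp: FP Q.carrier_quotient)
  from f have "P (Q.proj f)"
  proof (induction rule: free_algebra_induct)
    case zero
    then show ?case using assms(2) by (simp add: FP Q.zero_quotient)
  next
    case (add g c w)
    have "P (Q.proj g \<oplus>\<^bsub>FP\<^esub> c \<odot>\<^bsub>FP\<^esub> word w)"
      using add by (intro assms(3)) (auto simp: FP Q.carrier_quotient)
    then show ?case
      using add by (simp add: proj_monomial[symmetric] FP algebra_homD[OF Q.proj_hom])
  qed
  then show ?thesis by (simp add: x)
qed

lemma free_product_linear_eqI:
  assumes "L \<in> linear_maps FP M" "L' \<in> linear_maps FP M" "module complex_ring M"
    and "\<And>w. w \<in> lists X \<Longrightarrow> L (word w) = L' (word w)"
    and "x \<in> carrier FP"
  shows "L x = L' x"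
  using assms(5)
proof (induction rule: free_product_induct)
  case zero
  then show ?case
    using linear_map_zero[OF _ free_product_module assms(3)] assms by metis
next
  case (add g c w)
  interpret FP: module complex_ring FP by (rule free_product_module)
  show ?case
    using add assms by (simp add: word_closed linear_mapsD[OF assms(1)] linear_mapsD[OF assms(2)])
qed

text \<open>The universal property at the level of linear maps: a function on words descends once it
  respects the relations at every place of a word. The contexts \<open>u\<close> and
  \<open>v\<close> reflect that the ideal is two-sided while the map is only linear.\<close>

lemma free_product_linear_map:
  fixes M (structure)
  assumes M: "module complex_ring M"
    and e: "\<And>w. w \<in> lists X \<Longrightarrow> e w \<in> carrier M"
    and add: "\<And>u v i a b. \<lbrakk>u \<in> lists X; v \<in> lists X; i \<in> I; a \<in> carrier (A i); b \<in> carrier (A i)\<rbrakk> \<Longrightarrow>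
      e (u @ (i, a \<oplus>\<^bsub>A i\<^esub> b) # v) = e (u @ (i, a) # v) \<oplus> e (u @ (i, b) # v)"
    and smult: "\<And>u v i a c. \<lbrakk>u \<in> lists X; v \<in> lists X; i \<in> I; a \<in> carrier (A i)\<rbrakk> \<Longrightarrow>
      e (u @ (i, c \<odot>\<^bsub>A i\<^esub> a) # v) = c \<odot> e (u @ (i, a) # v)"
    and mult: "\<And>u v i a b. \<lbrakk>u \<in> lists X; v \<in> lists X; i \<in> I; a \<in> carrier (A i); b \<in> carrier (A i)\<rbrakk> \<Longrightarrow>
      e (u @ (i, a \<otimes>\<^bsub>A i\<^esub> b) # v) = e (u @ (i, a) # (i, b) # v)"
    and one: "\<And>u v i. \<lbrakk>u \<in> lists X; v \<in> lists X; i \<in> I\<rbrakk> \<Longrightarrow>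
      e (u @ (i, \<one>\<^bsub>A i\<^esub>) # v) = e (u @ v)"
  obtains L where "L \<in> linear_maps FP M" "\<And>w. w \<in> lists X \<Longrightarrow> L (word w) = e w"
proof -
  interpret M: module complex_ring M by fact
  interpret Q: quotient_by_ideal F N by (rule quotient)
  have FP: "FP = quotient_algebra F N" by (simp add: free_product_def)
  obtain L where L: "L \<in> linear_maps F M" and Le: "\<And>w. w \<in> lists X \<Longrightarrow> L (monomial w) = e w"
    by (rule free_algebra_linear_extension[OF M e]) (assumption, rule that)
  let ?K = "{x \<in> carrier F. \<forall>g\<in>carrier F. \<forall>h\<in>carrier F. L (g \<otimes>\<^bsub>F\<^esub> x \<otimes>\<^bsub>F\<^esub> h) = \<zero>}"
  have linear_combination_mult: "(g \<oplus>\<^bsub>F\<^esub> c \<odot>\<^bsub>F\<^esub> m) \<otimes>\<^bsub>F\<^esub> z \<otimes>\<^bsub>F\<^esub> k =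
      g \<otimes>\<^bsub>F\<^esub> z \<otimes>\<^bsub>F\<^esub> k \<oplus>\<^bsub>F\<^esub> c \<odot>\<^bsub>F\<^esub> (m \<otimes>\<^bsub>F\<^esub> z \<otimes>\<^bsub>F\<^esub> k)"
    if "g \<in> carrier F" "m \<in> carrier F" "z \<in> carrier F" "k \<in> carrier F" for g c m z k
    using that by (simp add: Q.A.l_distr Q.A.smult_assoc_left)
  have mult_linear_combination: "k \<otimes>\<^bsub>F\<^esub> z \<otimes>\<^bsub>F\<^esub> (g \<oplus>\<^bsub>F\<^esub> c \<odot>\<^bsub>F\<^esub> m) =
      k \<otimes>\<^bsub>F\<^esub> z \<otimes>\<^bsub>F\<^esub> g \<oplus>\<^bsub>F\<^esub> c \<odot>\<^bsub>F\<^esub> (k \<otimes>\<^bsub>F\<^esub> z \<otimes>\<^bsub>F\<^esub> m)"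
    if "g \<in> carrier F" "m \<in> carrier F" "z \<in> carrier F" "k \<in> carrier F" for g c m z k
    using that by (simp add: Q.A.r_distr Q.A.smult_assoc_right)
  \<comment> \<open>Both sides are linear in each outer factor, so testing on monomials
    suffices.\<close>
  have K: "x \<ominus>\<^bsub>F\<^esub> y \<in> ?K"
    if xy: "x \<in> carrier F" "y \<in> carrier F"
      and eq: "\<And>u v. u \<in> lists X \<Longrightarrow> v \<in> lists X \<Longrightarrow>
        L (monomial u \<otimes>\<^bsub>F\<^esub> x \<otimes>\<^bsub>F\<^esub> monomial v) = L (monomial u \<otimes>\<^bsub>F\<^esub> y \<otimes>\<^bsub>F\<^esub> monomial v)" for x y
  proof -
    have mon: "L (g \<otimes>\<^bsub>F\<^esub> x \<otimes>\<^bsub>F\<^esub> monomial v) = L (g \<otimes>\<^bsub>F\<^esub> y \<otimes>\<^bsub>F\<^esub> monomial v)"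
      if "g \<in> carrier F" "v \<in> lists X" for g v
      using that(1)
    proof (induction rule: free_algebra_induct)
      case zero
      then show ?case using xy that(2) by simp
    next
      case (add g c w)
      then show ?case
        using xy that(2) eq[OF add(2) that(2)] linear_combination_mult
        by (simp add: linear_mapsD[OF L] del: in_lists_conv_set)
    qed
    have "L (g \<otimes>\<^bsub>F\<^esub> x \<otimes>\<^bsub>F\<^esub> h) = L (g \<otimes>\<^bsub>F\<^esub> y \<otimes>\<^bsub>F\<^esub> h)" if "g \<in> carrier F" "h \<in> carrier F" for g h
      using that(2)
    proof (induction rule: free_algebra_induct)
      case zero
      then show ?case using xy that(1) by simp
    next
      case (add h c w)
      then show ?case
        using xy that(1) mon[OF that(1) add(2)] mult_linear_combination
        by (simp add: linear_mapsD[OF L] del: in_lists_conv_set)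
    qed
    moreover have "L (g \<otimes>\<^bsub>F\<^esub> (x \<ominus>\<^bsub>F\<^esub> y) \<otimes>\<^bsub>F\<^esub> h) =
        L (g \<otimes>\<^bsub>F\<^esub> x \<otimes>\<^bsub>F\<^esub> h) \<ominus> L (g \<otimes>\<^bsub>F\<^esub> y \<otimes>\<^bsub>F\<^esub> h)"
      if "g \<in> carrier F" "h \<in> carrier F" for g h
      using that xy linear_map_diff[OF L Q.A.module_axioms M]
      by (simp add: a_minus_def Q.A.l_distr Q.A.r_distr Q.A.l_minus Q.A.r_minus)
    moreover have "z \<ominus> z = \<zero>" if "z \<in> carrier M" for z
      using that by (simp add: a_minus_def M.r_neg)
    ultimately show ?thesis
      using xy linear_mapsD(1)[OF L] by simp
  qed
  note [simp] = free_var_eq_monomial family_closed linear_mapsD[OF L]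
  have rel1: "free_var (i, a \<oplus>\<^bsub>A i\<^esub> b) \<ominus>\<^bsub>F\<^esub> (free_var (i, a) \<oplus>\<^bsub>F\<^esub> free_var (i, b)) \<in> ?K"
    if "i \<in> I" "a \<in> carrier (A i)" "b \<in> carrier (A i)" for i a b
    using that
      by (intro K) (simp_all add: Q.A.r_distr Q.A.l_distr monomial_mult Le add)
  have rel2: "free_var (i, c \<odot>\<^bsub>A i\<^esub> a) \<ominus>\<^bsub>F\<^esub> (c \<odot>\<^bsub>F\<^esub> free_var (i, a)) \<in> ?K"
    if "i \<in> I" "a \<in> carrier (A i)" for i a c
    using that
      by (intro K)
        (simp_all add: Q.A.smult_assoc_left Q.A.smult_assoc_right monomial_mult Le smult)
  have rel3: "free_var (i, a \<otimes>\<^bsub>A i\<^esub> b) \<ominus>\<^bsub>F\<^esub> (free_var (i, a) \<otimes>\<^bsub>F\<^esub> free_var (i, b)) \<in> ?K"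
    if "i \<in> I" "a \<in> carrier (A i)" "b \<in> carrier (A i)" for i a b
    using that
      by (intro K) (simp_all add: monomial_mult Le mult)
  have rel4: "free_var (i, \<one>\<^bsub>A i\<^esub>) \<ominus>\<^bsub>F\<^esub> \<one>\<^bsub>F\<^esub> \<in> ?K"
    if "i \<in> I" for i
    using that
      by (intro K) (simp_all add: monomial_mult Le one)
  have "free_product_rels I A \<subseteq> ?K"
    unfolding free_product_rels_def Let_def
    by (intro Un_least subsetI; elim CollectE exE conjE; simp only: rel1 rel2 rel3 rel4)
  then have "N \<subseteq> ?K"
    unfolding free_product_ideal_def
    using linear_annihilator_ideal[OF free_algebra M L] by (intro Q.A.genideal_minimal)
  have "L x = \<zero>" if "x \<in> N" for x
  proof -
    have "x \<in> ?K" using \<open>N \<subseteq> ?K\<close> that by blast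
    then have "L (\<one>\<^bsub>F\<^esub> \<otimes>\<^bsub>F\<^esub> x \<otimes>\<^bsub>F\<^esub> \<one>\<^bsub>F\<^esub>) = \<zero>" "x \<in> carrier F"
      using Q.A.one_closed by blast+
    then show ?thesis by simp
  qed
  then obtain L' where L': "L' \<in> linear_maps FP M" "\<And>x. x \<in> carrier F \<Longrightarrow> L' (Q.proj x) = L x"
    unfolding FP by (rule Q.quotient_linear_map[OF L M]) (assumption, rule that[unfolded FP])
  have "L' (word w) = e w" if "w \<in> lists X" for w
    using that L'(2)[of "monomial w"] Le[of w] by (simp add: proj_monomial del: in_lists_conv_set)
  with L'(1) show ?thesis by (rule that)
qed

text \<open>\<open>e\<close> multiplies the images of the letters. It turns concatenation into
  multiplication, and since words span, its linear extension is multiplicative.\<close>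

lemma free_product_hom:
  assumes B: "complex_algebra B"
    and g: "\<And>i. i \<in> I \<Longrightarrow> g i \<in> algebra_hom (A i) B"
  obtains h where "h \<in> algebra_hom FP B"
    "\<And>i a. i \<in> I \<Longrightarrow> a \<in> carrier (A i) \<Longrightarrow> h (inc i a) = g i a"
proof -
  interpret B: complex_algebra B by fact
  interpret B: ring B by (rule B.ring_axioms)
  interpret FP: complex_algebra FP by (rule complex_algebra_free_product)
  interpret FP: ring FP by (rule free_product_ring)
  let ?l = "\<lambda>(i, a). g i a"
  define e where "e w = list_prod B (map ?l w)" for w
  have l: "?l x \<in> carrier B" if "x \<in> X" for x
    using that algebra_homD(1)[OF g] by (cases x) auto
  then have ls: "set (map ?l w) \<subseteq> carrier B" if "w \<in> lists X" for w
    using that by (auto simp del: split_paired_All)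
  then have e: "e w \<in> carrier B" if "w \<in> lists X" for w
    unfolding e_def using that by (intro B.list_prod_closed)
  have e_append: "e (u @ v) = e u \<otimes>\<^bsub>B\<^esub> e v" if "u \<in> lists X" "v \<in> lists X" for u v
    unfolding e_def map_append using that by (intro B.list_prod_append ls)
  have e_Cons: "e ((i, a) # w) = g i a \<otimes>\<^bsub>B\<^esub> e w" for i a w
    by (simp add: e_def)
  have gc: "g i a \<in> carrier B" if "i \<in> I" "a \<in> carrier (A i)" for i a
    using that algebra_homD(1)[OF g] by simp
  note [simp] = family_closed e_append e_Cons gc e
  have e_add: "e (u @ (i, a \<oplus>\<^bsub>A i\<^esub> b) # v) = e (u @ (i, a) # v) \<oplus>\<^bsub>B\<^esub> e (u @ (i, b) # v)"
    and e_mult: "e (u @ (i, a \<otimes>\<^bsub>A i\<^esub> b) # v) = e (u @ (i, a) # (i, b) # v)"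
    if "u \<in> lists X" "v \<in> lists X" "i \<in> I" "a \<in> carrier (A i)" "b \<in> carrier (A i)"
    for u v i a b
    using that by (simp_all add: algebra_homD[OF g] B.l_distr B.r_distr B.m_assoc)
  have e_smult: "e (u @ (i, c \<odot>\<^bsub>A i\<^esub> a) # v) = c \<odot>\<^bsub>B\<^esub> e (u @ (i, a) # v)"
    and e_one: "e (u @ (i, \<one>\<^bsub>A i\<^esub>) # v) = e (u @ v)"
    if "u \<in> lists X" "v \<in> lists X" "i \<in> I" "a \<in> carrier (A i)"
    for u v i a c
    using that by (simp_all add: algebra_homD[OF g] B.smult_assoc_left B.smult_assoc_right)
  obtain h where h: "h \<in> linear_maps FP B" and he: "\<And>w. w \<in> lists X \<Longrightarrow> h (word w) = e w"
    by (rule free_product_linear_map[OF B.module_axioms, of e])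
      (rule e e_add e_mult e_smult e_one[OF _ _ _ family_closed(4)] that; assumption)+
  show ?thesis
  proof
    show hinc: "h (inc i a) = g i a" if "i \<in> I" "a \<in> carrier (A i)" for i a
      using that he[of "[(i, a)]"] by (simp add: word_singleton letter_def e_def)
    show "h \<in> algebra_hom FP B"
    proof (rule algebra_homI)
      show "h \<one>\<^bsub>FP\<^esub> = \<one>\<^bsub>B\<^esub>"
        using he[of "[]"] by (simp add: e_def)
      have word: "h (x \<otimes>\<^bsub>FP\<^esub> word w) = h x \<otimes>\<^bsub>B\<^esub> h (word w)" if "x \<in> carrier FP" "w \<in> lists X" for x w
        using that(1)
      proof (induction rule: free_product_induct)
        case zero
        then show ?case
          using that(2) word_closed e he
          by (simp add: linear_map_zero[OF h FP.module_axioms B.module_axioms] del: in_lists_conv_set)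
      next
        case (add x c v)
        then show ?case
          using that(2) word_closed[of "v @ w"] he[of "v @ w"] word_closed e he
          by (simp add: linear_mapsD[OF h] FP.l_distr FP.smult_assoc_left B.l_distr
              B.smult_assoc_left word_append[symmetric] del: in_lists_conv_set)
      qed
      show "h (x \<otimes>\<^bsub>FP\<^esub> y) = h x \<otimes>\<^bsub>B\<^esub> h y" if "x \<in> carrier FP" "y \<in> carrier FP" for x y
        using that(2)
      proof (induction rule: free_product_induct)
        case zero
        then show ?case
          using that(1) linear_mapsD(1)[OF h]
          by (simp add: linear_map_zero[OF h FP.module_axioms B.module_axioms])
      next
        case (add y c v)
        then show ?case
          using that(1) word_closed word
          by (simp add: linear_mapsD[OF h] FP.r_distr FP.smult_assoc_right B.r_distr
              B.smult_assoc_right del: in_lists_conv_set)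
      qed
    qed (auto simp: linear_mapsD[OF h])
  qed
qed

lemma free_product_hom_eqI:
  assumes B: "complex_algebra B" and h: "h \<in> algebra_hom FP B" "h' \<in> algebra_hom FP B"
    and eq: "\<And>i a. i \<in> I \<Longrightarrow> a \<in> carrier (A i) \<Longrightarrow> h (inc i a) = h' (inc i a)"
    and "x \<in> carrier FP"
  shows "h x = h' x"
proof (rule free_product_linear_eqI[OF algebra_hom_linear[OF h(1)] algebra_hom_linear[OF h(2)] _ _ assms(5)])
  show "module complex_ring B" using B by (simp add: complex_algebra_def)
  show "h (word w) = h' (word w)" if "w \<in> lists X" for w
    using that
  proof (induction w)
    case Nil
    then show ?case by (simp add: algebra_homD[OF h(1)] algebra_homD[OF h(2)])
  next
    case (Cons x w)
    obtain i a where x: "x = (i, a)" by fastforce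
    with Cons show ?case
      using letter_closed[of x] word_closed[of w] eq[of i a]
      by (simp add: word_Cons algebra_homD(3)[OF h(1)] algebra_homD(3)[OF h(2)] letter_def)
  qed
qed

end

section \<open>Words under the relations of the free product\<close>

context algebra_family
begin

text \<open>Additivity and homogeneity in one identity, the form needed to split a letter into a
  centered part and a multiple of the unit.\<close>

lemma word_add:
  assumes "u \<in> lists X" "v \<in> lists X" "i \<in> I" "a \<in> carrier (A i)" "b \<in> carrier (A i)"
  shows "word (u @ (i, a \<oplus>\<^bsub>A i\<^esub> c \<odot>\<^bsub>A i\<^esub> b) # v) =
    word (u @ (i, a) # v) \<oplus>\<^bsub>FP\<^esub> c \<odot>\<^bsub>FP\<^esub> word (u @ (i, b) # v)"
proof -
  interpret FP: complex_algebra FP by (rule complex_algebra_free_product)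
  interpret FP: ring FP by (rule free_product_ring)
  have "letter (i, a \<oplus>\<^bsub>A i\<^esub> c \<odot>\<^bsub>A i\<^esub> b) = letter (i, a) \<oplus>\<^bsub>FP\<^esub> c \<odot>\<^bsub>FP\<^esub> letter (i, b)"
    using assms family_closed by (simp add: letter_def algebra_homD[OF inc_hom])
  then show ?thesis
    using assms word_closed[OF assms(1)] word_closed[OF assms(2)] family_closed[OF assms(3)]
      letter_closed[of "(i, a)"] letter_closed[of "(i, b)"]
    by (simp add: word_append word_Cons FP.l_distr FP.r_distr FP.smult_assoc_left
        FP.smult_assoc_right)
qed

lemma word_mult:
  assumes "u \<in> lists X" "v \<in> lists X" "i \<in> I" "a \<in> carrier (A i)" "b \<in> carrier (A i)"
  shows "word (u @ (i, a \<otimes>\<^bsub>A i\<^esub> b) # v) = word (u @ (i, a) # (i, b) # v)"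
proof -
  interpret FP: ring FP by (rule free_product_ring)
  show ?thesis
    using assms word_closed[OF assms(1)] word_closed[OF assms(2)] family_closed[OF assms(3)]
      letter_closed[of "(i, a)"] letter_closed[of "(i, b)"]
    by (simp add: word_append word_Cons letter_def algebra_homD[OF inc_hom] FP.m_assoc)
qed

lemma word_one:
  assumes "u \<in> lists X" "v \<in> lists X" "i \<in> I"
  shows "word (u @ (i, \<one>\<^bsub>A i\<^esub>) # v) = word (u @ v)"
proof -
  interpret FP: ring FP by (rule free_product_ring)
  show ?thesis
    using assms word_closed[OF assms(2)] family_closed[OF assms(3)]
    by (simp add: word_append word_Cons letter_def algebra_homD[OF inc_hom])
qed

end

section \<open>Evaluation of words on a stack\<close>

definition stack_functional ::
  "('a prob_space3 \<Rightarrow> 'a \<Rightarrow> complex) \<Rightarrow> ('i::linorder \<Rightarrow> 'a prob_space3) \<Rightarrow> ('i \<times> 'a) list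
    \<Rightarrow> 'i \<Rightarrow> 'a \<Rightarrow> complex" where
  "stack_functional base P S i =
     (case S of [] \<Rightarrow> base (P i) | x # _ \<Rightarrow> if fst x < i then psi (P i) else theta (P i))"

text \<open>Only the index of the top entry is inspected, never its algebra element. This is what
  makes the evaluation linear in every stack entry.\<close>

lemma stack_functional_cong:
  "map fst S = map fst T \<Longrightarrow> stack_functional base P S = stack_functional base P T"
  by (cases S; cases T) (auto simp: stack_functional_def)

text \<open>The head of the list is the top of the stack, that is, the letter read last; the word
  belonging to the stack is therefore \<open>rev S\<close>.\<close>

primrec stack_ok ::
  "('a prob_space3 \<Rightarrow> 'a \<Rightarrow> complex) \<Rightarrow> 'i::linorder set \<Rightarrow> ('i \<Rightarrow> 'a prob_space3)
    \<Rightarrow> ('i \<times> 'a) list \<Rightarrow> bool" where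
  "stack_ok base I P [] \<longleftrightarrow> True"
| "stack_ok base I P (x # S) \<longleftrightarrow> fst x \<in> I \<and> snd x \<in> carrier (alg (P (fst x))) \<and>
     (S \<noteq> [] \<longrightarrow> fst (hd S) \<noteq> fst x) \<and> stack_functional base P S (fst x) (snd x) = 0 \<and>
     stack_ok base I P S"

locale space_family =
  fixes I :: "'i::linorder set" and P :: "'i \<Rightarrow> 'a prob_space3"
    and base :: "'a prob_space3 \<Rightarrow> 'a \<Rightarrow> complex"
  assumes space: "i \<in> I \<Longrightarrow> unital_prob_space3 (P i)"
    and base: "base \<in> {phi, psi, theta}"
begin

sublocale algebra_family I "\<lambda>i. alg (P i)"
  using space by (simp add: algebra_family_def unital_prob_space3_def)

abbreviation "chi \<equiv> stack_functional base P"
abbreviation "ok \<equiv> stack_ok base I P"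

definition center :: "'i \<Rightarrow> complex \<Rightarrow> 'a \<Rightarrow> 'a" where
  "center i c a = a \<oplus>\<^bsub>alg (P i)\<^esub> (- c) \<odot>\<^bsub>alg (P i)\<^esub> \<one>\<^bsub>alg (P i)\<^esub>"

definition pop :: "('i \<times> 'a) list \<Rightarrow> 'i \<Rightarrow> ('i \<times> 'a) list" where
  "pop S i = (if S \<noteq> [] \<and> fst (hd S) = i then tl S else S)"

definition merge :: "('i \<times> 'a) list \<Rightarrow> 'i \<Rightarrow> 'a \<Rightarrow> 'a" where
  "merge S i a = (if S \<noteq> [] \<and> fst (hd S) = i then snd (hd S) \<otimes>\<^bsub>alg (P i)\<^esub> a else a)"

text \<open>The base case encodes that a nonempty centered stack stands for a word of value zero. In
  the recursive case the first summand is the branch in which the scalar part drops out, the second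
  the branch in which the centered part stays on the stack.\<close>

primrec ev :: "('i \<times> 'a) list \<Rightarrow> ('i \<times> 'a) list \<Rightarrow> complex" where
  "ev [] S = (if S = [] then 1 else 0)"
| "ev (x # w) S = (let i = fst x; T = pop S i; b = merge S i (snd x); c = chi T i b in
     c * ev w T + ev w ((i, center i c b) # T))"

text \<open>One step of \<open>ev\<close> after popping and merging. It is linear in the merged
  element \<open>b\<close>, which allows different ways of producing \<open>b\<close> to be
  compared.\<close>

definition push :: "('i \<times> 'a) list \<Rightarrow> ('i \<times> 'a) list \<Rightarrow> 'i \<Rightarrow> 'a \<Rightarrow> complex" where
  "push w T i b = chi T i b * ev w T + ev w ((i, center i (chi T i b) b) # T)"

lemma ev_Cons: "ev ((i, a) # w) S = push w (pop S i) i (merge S i a)"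
  by (simp add: push_def Let_def)

declare ev.simps(2) [simp del]

lemma pop_Cons [simp]: "pop ((j, b) # S) i = (if j = i then S else (j, b) # S)"
  by (simp add: pop_def)

lemma merge_Cons [simp]: "merge ((j, b) # S) i a = (if j = i then b \<otimes>\<^bsub>alg (P i)\<^esub> a else a)"
  by (simp add: merge_def)

lemma chi_unital:
  assumes "i \<in> I"
  shows "unital_functional (alg (P i)) (chi S i)"
  using space[OF assms] base by (auto simp: stack_functional_def unital_prob_space3_def split: list.split)

lemma chi_simps:
  assumes "i \<in> I"
  shows "a \<in> carrier (alg (P i)) \<Longrightarrow> b \<in> carrier (alg (P i)) \<Longrightarrow>
      chi S i (a \<oplus>\<^bsub>alg (P i)\<^esub> b) = chi S i a + chi S i b"
    and "a \<in> carrier (alg (P i)) \<Longrightarrow> chi S i (c \<odot>\<^bsub>alg (P i)\<^esub> a) = c * chi S i a"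
    and "chi S i \<one>\<^bsub>alg (P i)\<^esub> = 1"
  using chi_unital[OF assms, of S] by (auto simp: unital_functional_def)

lemma center_closed: "i \<in> I \<Longrightarrow> a \<in> carrier (alg (P i)) \<Longrightarrow> center i c a \<in> carrier (alg (P i))"
  by (simp add: center_def family_closed)

lemma chi_center:
  "i \<in> I \<Longrightarrow> a \<in> carrier (alg (P i)) \<Longrightarrow> chi S i (center i (chi S i a) a) = 0"
  by (simp add: center_def chi_simps family_closed)

lemma center_linear:
  assumes "i \<in> I" "x \<in> carrier (alg (P i))" "y \<in> carrier (alg (P i))"
  shows "center i (d + c * e) (x \<oplus>\<^bsub>alg (P i)\<^esub> c \<odot>\<^bsub>alg (P i)\<^esub> y) =
    center i d x \<oplus>\<^bsub>alg (P i)\<^esub> c \<odot>\<^bsub>alg (P i)\<^esub> center i e y"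
proof -
  interpret Ai: complex_algebra "alg (P i)" using assms(1) by (rule algebra)
  have "(- (d + c * e)) \<odot>\<^bsub>alg (P i)\<^esub> \<one>\<^bsub>alg (P i)\<^esub> =
      (- d) \<odot>\<^bsub>alg (P i)\<^esub> \<one>\<^bsub>alg (P i)\<^esub> \<oplus>\<^bsub>alg (P i)\<^esub>
      c \<odot>\<^bsub>alg (P i)\<^esub> ((- e) \<odot>\<^bsub>alg (P i)\<^esub> \<one>\<^bsub>alg (P i)\<^esub>)"
    by (subst complex_module_rules[OF Ai.module_axioms, symmetric]; simp?)+
  then show ?thesis
    using assms by (simp add: center_def Ai.smult_r_distr Ai.M.a_ac)
qed

text \<open>The varying entry may be buried under \<open>U\<close>, because reading pushes entries
  over it and popping exposes it again. The functionals chosen on the way depend on indices only and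
  so agree for \<open>x\<close>, \<open>y\<close> and their combination. Once the entry is on top
  and meets its own index, linearity passes through multiplication, \<open>chi\<close> and
  centering.\<close>

lemma ev_linear:
  assumes "w \<in> lists X" "i \<in> I" "x \<in> carrier (alg (P i))" "y \<in> carrier (alg (P i))"
  shows "ev w (U @ (i, x \<oplus>\<^bsub>alg (P i)\<^esub> c \<odot>\<^bsub>alg (P i)\<^esub> y) # S) =
    ev w (U @ (i, x) # S) + c * ev w (U @ (i, y) # S)"
  using assms
proof (induction w arbitrary: U x y S rule: list.induct)
  case Nil
  then show ?case by simp
next
  case (Cons l w)
  obtain j a where l: "l = (j, a)" by fastforce
  with Cons.prems have a: "j \<in> I" "a \<in> carrier (alg (P j))" and w: "w \<in> lists X" by auto
  interpret Ai: complex_algebra "alg (P i)" using Cons.prems(2) by (rule algebra)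
  interpret Ai: ring "alg (P i)" by (rule Ai.ring_axioms)
  note IH = Cons.IH[OF w Cons.prems(2)]
  let ?z = "x \<oplus>\<^bsub>alg (P i)\<^esub> c \<odot>\<^bsub>alg (P i)\<^esub> y"
  have chi: "chi (V @ (i, ?z) # S) = chi (V @ (i, x) # S)" "chi (V @ (i, y) # S) = chi (V @ (i, x) # S)" for V
    by (rule stack_functional_cong, simp)+
  show ?case
  proof (cases U)
    case Nil
    show ?thesis
    proof (cases "i = j")
      case True
      have z: "?z \<otimes>\<^bsub>alg (P i)\<^esub> a = x \<otimes>\<^bsub>alg (P i)\<^esub> a \<oplus>\<^bsub>alg (P i)\<^esub> c \<odot>\<^bsub>alg (P i)\<^esub> (y \<otimes>\<^bsub>alg (P i)\<^esub> a)"
        using a(2)[folded True] Cons.prems(3,4) by (simp add: Ai.l_distr Ai.smult_assoc_left)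
      have xa: "x \<otimes>\<^bsub>alg (P i)\<^esub> a \<in> carrier (alg (P i))" "y \<otimes>\<^bsub>alg (P i)\<^esub> a \<in> carrier (alg (P i))"
        using a(2)[folded True] Cons.prems(3,4) by simp_all
      let ?d = "chi S i (x \<otimes>\<^bsub>alg (P i)\<^esub> a)" and ?e = "chi S i (y \<otimes>\<^bsub>alg (P i)\<^esub> a)"
      have "chi S i (?z \<otimes>\<^bsub>alg (P i)\<^esub> a) = ?d + c * ?e"
        using xa Cons.prems(2) unfolding z by (simp add: chi_simps family_closed)
      moreover have "ev w ((i, center i (?d + c * ?e) (?z \<otimes>\<^bsub>alg (P i)\<^esub> a)) # S) =
          ev w ((i, center i ?d (x \<otimes>\<^bsub>alg (P i)\<^esub> a)) # S) + c * ev w ((i, center i ?e (y \<otimes>\<^bsub>alg (P i)\<^esub> a)) # S)"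
        using xa Cons.prems(2) IH[of _ _ "[]" S]
        unfolding z by (simp add: center_linear center_closed)
      ultimately show ?thesis
        using Nil True by (simp add: l ev_Cons push_def algebra_simps)
    next
      case False
      then show ?thesis
        using IH[OF Cons.prems(3,4), of "[]" S] IH[OF Cons.prems(3,4), of "[(j, _)]" S] Nil chi[of "[]"]
        by (simp add: l ev_Cons push_def algebra_simps)
    qed
  next
    case (Cons k U')
    show ?thesis
    proof (cases "fst k = j")
      case True
      then show ?thesis
        using IH[OF Cons.prems(3,4), of U' S] IH[OF Cons.prems(3,4), of "(j, _) # U'" S] Cons chi[of U']
        by (cases k) (simp add: l ev_Cons push_def algebra_simps)
    next
      case False
      then show ?thesis
        using IH[OF Cons.prems(3,4), of U S] IH[OF Cons.prems(3,4), of "(j, _) # U" S] Cons chi[of U]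
        by (cases k) (simp add: l ev_Cons push_def algebra_simps)
    qed
  qed
qed

text \<open>As \<open>0 = 0 + 1 * 0\<close> in the algebra, linearity turns the value
  \<open>v\<close> into \<open>v + v\<close>.\<close>

lemma ev_zero:
  assumes "w \<in> lists X" "i \<in> I"
  shows "ev w ((i, \<zero>\<^bsub>alg (P i)\<^esub>) # S) = 0"
proof -
  interpret Ai: complex_algebra "alg (P i)" using assms(2) by (rule algebra)
  have "\<zero>\<^bsub>alg (P i)\<^esub> \<oplus>\<^bsub>alg (P i)\<^esub> 1 \<odot>\<^bsub>alg (P i)\<^esub> \<zero>\<^bsub>alg (P i)\<^esub> = \<zero>\<^bsub>alg (P i)\<^esub>"
    using complex_module_rules(3)[OF Ai.module_axioms] by simp
  then show ?thesis
    using ev_linear[OF assms, of "\<zero>\<^bsub>alg (P i)\<^esub>" "\<zero>\<^bsub>alg (P i)\<^esub>" "[]" 1 S] family_closed[OF assms(2)] by simp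
qed

lemma push_linear:
  assumes "w \<in> lists X" "i \<in> I" "x \<in> carrier (alg (P i))" "y \<in> carrier (alg (P i))"
  shows "push w T i (x \<oplus>\<^bsub>alg (P i)\<^esub> c \<odot>\<^bsub>alg (P i)\<^esub> y) = push w T i x + c * push w T i y"
proof -
  have "chi T i (x \<oplus>\<^bsub>alg (P i)\<^esub> c \<odot>\<^bsub>alg (P i)\<^esub> y) = chi T i x + c * chi T i y"
    using assms by (simp add: chi_simps family_closed)
  then show ?thesis
    using assms ev_linear[OF assms(1,2), of _ _ "[]" c T]
    by (simp add: push_def center_linear center_closed algebra_simps)
qed

lemma ok_lists: "ok S \<Longrightarrow> S \<in> lists X"
  by (induction S) (auto simp: free_product_gens_def mem_Times_iff)

lemma ok_pop: "ok S \<Longrightarrow> ok (pop S i)"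
  by (cases S) (auto simp: pop_def)

lemma pop_hd: "ok S \<Longrightarrow> pop S i \<noteq> [] \<Longrightarrow> fst (hd (pop S i)) \<noteq> i"
  by (cases S) (auto simp: pop_def split: if_splits)

lemma pop_idem: "T \<noteq> [] \<longrightarrow> fst (hd T) \<noteq> i \<Longrightarrow> pop T i = T \<and> merge T i b = b"
  by (auto simp: pop_def merge_def)

lemma merge_closed:
  "ok S \<Longrightarrow> i \<in> I \<Longrightarrow> a \<in> carrier (alg (P i)) \<Longrightarrow> merge S i a \<in> carrier (alg (P i))"
  by (cases S) (auto simp: merge_def family_closed)

lemma ok_push:
  "ok T \<Longrightarrow> (T \<noteq> [] \<longrightarrow> fst (hd T) \<noteq> i) \<Longrightarrow> i \<in> I \<Longrightarrow> b \<in> carrier (alg (P i)) \<Longrightarrow>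
    ok ((i, center i (chi T i b) b) # T)"
  by (simp add: center_closed chi_center)

text \<open>Reading \<open>u\<close> leads from admissible stacks to admissible stacks, with weights
  independent of what follows. A linear relation between continuations that holds on all such stacks
  therefore survives any prefix; \<open>c = 0\<close> gives plain equalities.\<close>

lemma ev_prefix:
  assumes "\<And>S. ok S \<Longrightarrow> ev r S = ev r1 S + c * ev r2 S"
    and "u \<in> lists X" "ok S"
  shows "ev (u @ r) S = ev (u @ r1) S + c * ev (u @ r2) S"
  using assms(2,3)
proof (induction u arbitrary: S rule: list.induct)
  case Nil
  then show ?case using assms(1) by simp
next
  case (Cons l u)
  obtain i a where l: "l = (i, a)" by fastforce
  let ?b = "merge S i a" and ?T = "pop S i"
  have ia: "i \<in> I" "a \<in> carrier (alg (P i))" "u \<in> lists X"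
    using Cons.prems(1) by (simp_all add: l)
  have T: "ok ?T"
    by (rule ok_pop[OF Cons.prems(2)])
  have "ok ((i, center i (chi ?T i ?b) ?b) # ?T)"
    by (rule ok_push[OF T _ ia(1) merge_closed[OF Cons.prems(2) ia(1,2)]])
      (use pop_hd[OF Cons.prems(2)] in blast)
  with T ia(3) show ?case
    using Cons.IH[of ?T] Cons.IH[of "(i, center i (chi ?T i ?b) ?b) # ?T"]
    by (simp add: l ev_Cons push_def algebra_simps del: stack_ok.simps)
qed

lemma ev_add:
  assumes "w \<in> lists X" "ok S" "i \<in> I" "a \<in> carrier (alg (P i))" "b \<in> carrier (alg (P i))"
  shows "ev ((i, a \<oplus>\<^bsub>alg (P i)\<^esub> c \<odot>\<^bsub>alg (P i)\<^esub> b) # w) S = ev ((i, a) # w) S + c * ev ((i, b) # w) S"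
proof -
  interpret Ai: complex_algebra "alg (P i)" using assms(3) by (rule algebra)
  interpret Ai: ring "alg (P i)" by (rule Ai.ring_axioms)
  have "merge S i (a \<oplus>\<^bsub>alg (P i)\<^esub> c \<odot>\<^bsub>alg (P i)\<^esub> b) =
      merge S i a \<oplus>\<^bsub>alg (P i)\<^esub> c \<odot>\<^bsub>alg (P i)\<^esub> merge S i b"
    using assms by (cases S) (auto simp: merge_def Ai.r_distr Ai.smult_assoc_right)
  then show ?thesis
    using assms merge_closed push_linear by (simp add: ev_Cons)
qed

text \<open>Write the merged letter as \<open>m = c 1 + m0\<close> with \<open>m0\<close> centered.
  Reading \<open>b\<close> next either puts \<open>b\<close> on \<open>T\<close>, with weight
  \<open>c\<close>, or merges it into \<open>m0 b\<close>. By linearity of \<open>push\<close> this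
  is what \<open>m b = c b + m0 b\<close> yields in a single step.\<close>

lemma ev_mult:
  assumes "w \<in> lists X" "ok S" "i \<in> I" "a \<in> carrier (alg (P i))" "b \<in> carrier (alg (P i))"
  shows "ev ((i, a \<otimes>\<^bsub>alg (P i)\<^esub> b) # w) S = ev ((i, a) # (i, b) # w) S"
proof -
  interpret Ai: complex_algebra "alg (P i)" using assms(3) by (rule algebra)
  interpret Ai: ring "alg (P i)" by (rule Ai.ring_axioms)
  define T where "T = pop S i"
  define m where "m = merge S i a"
  have m: "m \<in> carrier (alg (P i))"
    using assms merge_closed by (simp add: m_def)
  \<comment> \<open>Neighbouring entries of an admissible stack have different indices, so after one
    pop the top no longer has index \<open>i\<close>.\<close>
  have T: "pop T i = T" "merge T i b = b"
    using pop_hd[OF assms(2), of i] pop_idem[of T i b] by (auto simp: T_def)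
  have mb: "merge S i (a \<otimes>\<^bsub>alg (P i)\<^esub> b) = m \<otimes>\<^bsub>alg (P i)\<^esub> b"
    using assms by (cases S) (auto simp: merge_def m_def Ai.m_assoc)
  define c where "c = chi T i m"
  have "center i c m \<otimes>\<^bsub>alg (P i)\<^esub> b \<oplus>\<^bsub>alg (P i)\<^esub> c \<odot>\<^bsub>alg (P i)\<^esub> b = m \<otimes>\<^bsub>alg (P i)\<^esub> b"
  proof -
    have "(- c) \<odot>\<^bsub>alg (P i)\<^esub> b \<oplus>\<^bsub>alg (P i)\<^esub> c \<odot>\<^bsub>alg (P i)\<^esub> b = \<zero>\<^bsub>alg (P i)\<^esub>"
      using assms(5) complex_module_rules(1,4)[OF Ai.module_axioms assms(5)]
      by (metis add.left_inverse)
    then show ?thesis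
      using m assms(5)
      by (simp add: center_def Ai.l_distr Ai.smult_assoc_left Ai.a_assoc)
  qed
  then have "push w T i (m \<otimes>\<^bsub>alg (P i)\<^esub> b) = push w T i (center i c m \<otimes>\<^bsub>alg (P i)\<^esub> b) + c * push w T i b"
    using push_linear[OF assms(1,3), of "center i c m \<otimes>\<^bsub>alg (P i)\<^esub> b" b T c] m assms center_closed by simp
  moreover have "ev ((i, a) # (i, b) # w) S = c * push w T i b + push w T i (center i c m \<otimes>\<^bsub>alg (P i)\<^esub> b)"
    unfolding ev_Cons[of i a]
    by (simp only: push_def[of "(i, b) # w"] T_def[symmetric] m_def[symmetric] c_def[symmetric])
      (simp add: ev_Cons T)
  ultimately show ?thesis
    by (simp add: ev_Cons[of i "a \<otimes>\<^bsub>alg (P i)\<^esub> b"] mb T_def)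
qed

text \<open>If the top has index \<open>i\<close>, merging the unit leaves an entry that is already
  centered: the scalar branch has weight 0 and the stack is unchanged. Otherwise the unit is purely
  scalar: weight 1 goes to the unchanged stack, and the other branch pushes a zero and vanishes by
  \<open>ev_zero\<close>.\<close>

lemma ev_one:
  assumes "w \<in> lists X" "ok S" "i \<in> I"
  shows "ev ((i, \<one>\<^bsub>alg (P i)\<^esub>) # w) S = ev w S"
proof -
  interpret Ai: complex_algebra "alg (P i)" using assms(3) by (rule algebra)
  interpret Ai: ring "alg (P i)" by (rule Ai.ring_axioms)
  note rules = complex_module_rules[OF Ai.module_axioms]
  show ?thesis
  proof (cases "S \<noteq> [] \<and> fst (hd S) = i")
    case True
    then obtain b S' where S: "S = (i, b) # S'" by (cases S) auto
    with assms(2) have b: "b \<in> carrier (alg (P i))" "chi S' i b = 0" by auto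
    then have "center i 0 b = b"
      using rules(4)[of "\<one>\<^bsub>alg (P i)\<^esub>"] by (simp add: center_def)
    then show ?thesis
      using b by (simp add: S ev_Cons push_def)
  next
    case False
    have "center i 1 \<one>\<^bsub>alg (P i)\<^esub> = \<zero>\<^bsub>alg (P i)\<^esub>"
      using rules(1)[of "\<one>\<^bsub>alg (P i)\<^esub>" 1 "- 1"] rules(3,4)[of "\<one>\<^bsub>alg (P i)\<^esub>"]
      by (simp add: center_def)
    then show ?thesis
      using False pop_idem[of S i] assms ev_zero[OF assms(1,3), of S]
      by (auto simp: ev_Cons push_def chi_simps)
  qed
qed

lemma ex_functional:
  obtains f where "unital_functional FP f" "\<And>w. w \<in> lists X \<Longrightarrow> f (word w) = ev w []"
proof -
  \<comment> \<open>\<open>ev_prefix\<close> moves the relations past an arbitrary prefix, as the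
    contexts in \<open>free_product_linear_map\<close> demand.\<close>
  have add: "ev (u @ (i, a \<oplus>\<^bsub>alg (P i)\<^esub> c \<odot>\<^bsub>alg (P i)\<^esub> b) # v) [] =
      ev (u @ (i, a) # v) [] + c * ev (u @ (i, b) # v) []"
    and mult: "ev (u @ (i, a \<otimes>\<^bsub>alg (P i)\<^esub> b) # v) [] = ev (u @ (i, a) # (i, b) # v) []"
    if "u \<in> lists X" "v \<in> lists X" "i \<in> I" "a \<in> carrier (alg (P i))" "b \<in> carrier (alg (P i))"
    for u v i a b c
    using that ev_prefix[OF ev_add, of v i a b u "[]" c]
      ev_prefix[of "(i, a \<otimes>\<^bsub>alg (P i)\<^esub> b) # v" "(i, a) # (i, b) # v" 0 _ u "[]"] ev_mult[of v]
    by auto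
  have one: "ev (u @ (i, \<one>\<^bsub>alg (P i)\<^esub>) # v) [] = ev (u @ v) []"
    if "u \<in> lists X" "v \<in> lists X" "i \<in> I" for u v i
    using that ev_prefix[of "(i, \<one>\<^bsub>alg (P i)\<^esub>) # v" v 0 _ u "[]"] ev_one[of v] by auto
  have plus: "ev (u @ (i, a \<oplus>\<^bsub>alg (P i)\<^esub> b) # v) [] = ev (u @ (i, a) # v) [] + ev (u @ (i, b) # v) []"
    if "u \<in> lists X" "v \<in> lists X" "i \<in> I" "a \<in> carrier (alg (P i))" "b \<in> carrier (alg (P i))"
    for u v i a b
  proof -
    interpret Ai: complex_algebra "alg (P i)" using that(3) by (rule algebra)
    show ?thesis
      using add[OF that, of 1] complex_module_rules(3)[OF Ai.module_axioms that(5)] by simp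
  qed
  have smult: "ev (u @ (i, c \<odot>\<^bsub>alg (P i)\<^esub> a) # v) [] = c * ev (u @ (i, a) # v) []"
    if "u \<in> lists X" "v \<in> lists X" "i \<in> I" "a \<in> carrier (alg (P i))" for u v i a c
  proof -
    interpret Ai: complex_algebra "alg (P i)" using that(3) by (rule algebra)
    \<comment> \<open>Additivity forces a zero letter to give the value 0; the combined identity
      with first summand zero is then homogeneity.\<close>
    have "ev (u @ (i, \<zero>\<^bsub>alg (P i)\<^esub>) # v) [] = 0"
      using plus[OF that(1-3), of "\<zero>\<^bsub>alg (P i)\<^esub>" "\<zero>\<^bsub>alg (P i)\<^esub>"] by simp
    then show ?thesis
      using add[OF that(1-3) _ that(4), of "\<zero>\<^bsub>alg (P i)\<^esub>" c] that by simp
  qed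
  obtain f where f: "f \<in> linear_maps FP complex_module" "\<And>w. w \<in> lists X \<Longrightarrow> f (word w) = ev w []"
    by (rule free_product_linear_map[OF module_complex_module, of "\<lambda>w. ev w []"])
      (use plus smult mult one that in auto)
  have "f \<one>\<^bsub>FP\<^esub> = 1" using f(2)[of "[]"] by simp
  with f that show ?thesis by (auto simp: unital_functional_iff_linear)
qed

end

section \<open>Kernel conditions, centered stacks and uniqueness\<close>

context space_family
begin

lemma word_product_eq:
  "word_product I (\<lambda>i. alg (P i)) is a = word (map (\<lambda>k. (is ! k, a k)) [0..<length is])"
  by (simp add: word_product_def word_def list_prod_def letter_def comp_def)

text \<open>Turns a condition that is recursive from the top into one by position from the bottom,
  the order in which \<open>position_functional\<close> counts.\<close>

lemma ok_nth:
  assumes "ok S" "k < length S"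
  shows "fst (rev S ! k) \<in> I" "snd (rev S ! k) \<in> carrier (alg (P (fst (rev S ! k))))"
    "0 < k \<Longrightarrow> fst (rev S ! (k - 1)) \<noteq> fst (rev S ! k)"
    "(if k = 0 then base (P (fst (rev S ! k)))
      else if fst (rev S ! (k - 1)) < fst (rev S ! k) then psi (P (fst (rev S ! k)))
      else theta (P (fst (rev S ! k)))) (snd (rev S ! k)) = 0"
proof -
  have "fst (rev S ! k) \<in> I \<and> snd (rev S ! k) \<in> carrier (alg (P (fst (rev S ! k)))) \<and>
    (0 < k \<longrightarrow> fst (rev S ! (k - 1)) \<noteq> fst (rev S ! k)) \<and>
    (if k = 0 then base (P (fst (rev S ! k)))
      else if fst (rev S ! (k - 1)) < fst (rev S ! k) then psi (P (fst (rev S ! k)))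
      else theta (P (fst (rev S ! k)))) (snd (rev S ! k)) = 0"
    using assms
  proof (induction S)
    case Nil
    then show ?case by simp
  next
    case (Cons x S)
    show ?case
    proof (cases "k < length S")
      case True
      then have "k - 1 < length S" by simp
      with True have "rev (x # S) ! k = rev S ! k" "rev (x # S) ! (k - 1) = rev S ! (k - 1)"
        by (simp_all only: rev.simps nth_append length_rev if_True)
      with True Cons show ?thesis by (simp only: stack_ok.simps) simp
    next
      case False
      with Cons.prems have k: "k = length S" by simp
      then have x: "rev (x # S) ! k = x"
        by (simp add: nth_append)
      show ?thesis
      proof (cases S)
        case Nil
        with Cons.prems k x show ?thesis by (simp add: stack_functional_def)
      next
        case (Cons y S')
        then have "rev (x # S) ! (k - 1) = y" by (simp add: k nth_append)
        with Cons.prems k x Cons show ?thesis by (auto simp: stack_functional_def)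
      qed
    qed
  qed
  then show "fst (rev S ! k) \<in> I" "snd (rev S ! k) \<in> carrier (alg (P (fst (rev S ! k))))"
    "0 < k \<Longrightarrow> fst (rev S ! (k - 1)) \<noteq> fst (rev S ! k)"
    "(if k = 0 then base (P (fst (rev S ! k)))
      else if fst (rev S ! (k - 1)) < fst (rev S ! k) then psi (P (fst (rev S ! k)))
      else theta (P (fst (rev S ! k)))) (snd (rev S ! k)) = 0"
    by blast+
qed

text \<open>A peak has an ascent on its left and a bottom a descent. So at each position the kernel
  condition uses either the functional of the stack or the zero functional, and a centered stack
  satisfies it.\<close>

lemma vanishes_on_stacks:
  assumes "vanishes_on_kernels base I P f" "ok S" "S \<noteq> []"
  shows "f (word (rev S)) = 0"
proof -
  let ?is = "map fst (rev S)" and ?a = "\<lambda>k. snd (rev S ! k)"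
  note S = ok_nth[OF assms(2)]
  have "distinct_adj ?is"
    unfolding distinct_adj_conv_nth
  proof (intro allI impI)
    fix k assume "Suc k < length ?is"
    then show "?is ! k \<noteq> ?is ! Suc k"
      using S(3)[of "Suc k"] by simp
  qed
  moreover have "set ?is \<subseteq> I"
    using ok_lists[OF assms(2)] by (auto simp: free_product_gens_def)
  ultimately have "?is \<in> alternating I"
    using assms(3) by (simp add: alternating_def)
  moreover have "?a k \<in> carrier (alg (P (?is ! k))) \<and> position_functional base P ?is k (?a k) = 0"
    if "k < length ?is" for k
  proof (cases "k = 0")
    case True
    then show ?thesis
      using S(2,4)[of 0] assms(3) by (simp add: position_functional_def)
  next
    case False
    have nth: "?is ! k = fst (rev S ! k)" "?is ! (k - 1) = fst (rev S ! (k - 1))"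
      using that by (auto intro!: nth_map)
    have "fst (rev S ! (k - 1)) < fst (rev S ! k)" if "k \<in> Peak ?is"
      using that nth by (simp add: Peak_def)
    moreover have "\<not> fst (rev S ! (k - 1)) < fst (rev S ! k)" if "k \<in> Bot ?is"
      using that nth by (auto simp: Bot_def)
    ultimately show ?thesis
      using S(2,4)[of k] that False by (auto simp: position_functional_def split: if_split_asm)
  qed
  ultimately have "f (word_product I (\<lambda>i. alg (P i)) ?is ?a) = 0"
    using assms(1)[unfolded vanishes_on_kernels_def, rule_format, of ?is ?a] by blast
  moreover have "map (\<lambda>k. (?is ! k, ?a k)) [0..<length ?is] = rev S"
    by (rule nth_equalityI) simp_all
  ultimately show ?thesis by (simp only: word_product_eq)
qed

text \<open>With the stack kept as a prefix, the values of \<open>f\<close> on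
  \<open>rev S @ w\<close> obey the recursion of \<open>ev w S\<close>: merging is a relation of the
  free product, splitting is linearity, and at \<open>w = []\<close> vanishing and unitality give
  the base case.\<close>

lemma functional_eq_ev:
  assumes f: "unital_functional FP f"
    and vanish: "\<And>S. ok S \<Longrightarrow> S \<noteq> [] \<Longrightarrow> f (word (rev S)) = 0"
    and "w \<in> lists X"
  shows "f (word w) = ev w []"
proof -
  have add: "f (x \<oplus>\<^bsub>FP\<^esub> c \<odot>\<^bsub>FP\<^esub> y) = f x + c * f y" if "x \<in> carrier FP" "y \<in> carrier FP" for x y c
  proof -
    interpret FP: module complex_ring FP by (rule free_product_module)
    show ?thesis using f that by (simp add: unital_functional_def)
  qed
  have "f (word (rev S @ w)) = ev w S" if "w \<in> lists X" "ok S" for S w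
    using that
  proof (induction w arbitrary: S rule: list.induct)
    case Nil
    then show ?case using vanish f by (auto simp: unital_functional_def)
  next
    case (Cons l w)
    obtain i a where l: "l = (i, a)" by fastforce
    have ia: "i \<in> I" "a \<in> carrier (alg (P i))" "w \<in> lists X"
      using Cons.prems(1) by (simp_all add: l)
    interpret Ai: complex_algebra "alg (P i)" using ia(1) by (rule algebra)
    interpret Ai: ring "alg (P i)" by (rule Ai.ring_axioms)
    define T where "T = pop S i"
    define b where "b = merge S i a"
    have T: "ok T" unfolding T_def by (rule ok_pop[OF Cons.prems(2)])
    have b: "b \<in> carrier (alg (P i))"
      unfolding b_def by (rule merge_closed[OF Cons.prems(2) ia(1,2)])
    have push: "ok ((i, center i (chi T i b) b) # T)"
      by (rule ok_push[OF T _ ia(1) b]) (simp add: T_def pop_hd[OF Cons.prems(2)])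
    have rev_lists: "rev T \<in> lists X" using ok_lists[OF T] by auto
    have word: "word (rev S @ (i, a) # w) = word (rev T @ (i, b) # w)"
    proof (cases "S \<noteq> [] \<and> fst (hd S) = i")
      case True
      then obtain c S' where S: "S = (i, c) # S'" by (cases S) auto
      then have "rev S' \<in> lists X" "c \<in> carrier (alg (P i))"
        using ok_lists[OF Cons.prems(2)] by auto
      then show ?thesis
        using word_mult[of "rev S'" w i c a] ia by (simp add: S T_def b_def)
    next
      case False
      then show ?thesis by (auto simp: T_def b_def pop_def merge_def)
    qed
    have "center i (chi T i b) b \<oplus>\<^bsub>alg (P i)\<^esub> chi T i b \<odot>\<^bsub>alg (P i)\<^esub> \<one>\<^bsub>alg (P i)\<^esub> = b"
    proof -
      have "(- chi T i b) \<odot>\<^bsub>alg (P i)\<^esub> \<one>\<^bsub>alg (P i)\<^esub> \<oplus>\<^bsub>alg (P i)\<^esub>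
          chi T i b \<odot>\<^bsub>alg (P i)\<^esub> \<one>\<^bsub>alg (P i)\<^esub> = \<zero>\<^bsub>alg (P i)\<^esub>"
        using complex_module_rules(1,4)[OF Ai.module_axioms Ai.one_closed]
        by (metis add.left_inverse)
      then show ?thesis
        using b by (simp add: center_def Ai.a_assoc)
    qed
    then have "word (rev T @ (i, b) # w) =
        word (rev T @ (i, center i (chi T i b) b) # w) \<oplus>\<^bsub>FP\<^esub> chi T i b \<odot>\<^bsub>FP\<^esub> word (rev T @ w)"
      using word_add[OF rev_lists ia(3,1) center_closed[OF ia(1) b] Ai.one_closed, of "chi T i b" "chi T i b"]
        word_one[OF rev_lists ia(3,1)]
      by simp
    moreover have "word (rev T @ (i, center i (chi T i b) b) # w) \<in> carrier FP" "word (rev T @ w) \<in> carrier FP"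
      by (rule word_closed, use rev_lists ia b center_closed in simp)+
    ultimately have "f (word (rev S @ (i, a) # w)) =
        f (word (rev T @ (i, center i (chi T i b) b) # w)) + chi T i b * f (word (rev T @ w))"
      using word add by simp
    also have "\<dots> = push w T i b"
      using Cons.IH[OF ia(3) T] Cons.IH[OF ia(3) push] by (simp add: push_def)
    also have "\<dots> = ev (l # w) S"
      by (simp add: l ev_Cons T_def b_def)
    finally show ?case by (simp add: l)
  qed
  from this[of w "[]"] assms(3) show ?thesis by simp
qed

text \<open>A letter at a monotone or final position may fail to be centered for the functional of
  the stack, so its scalar branch can carry weight. That branch still contributes nothing: no letter
  ever merges, so a stack that has become nonempty stays so, and the first letter is centered for
  \<open>base\<close> and thus always remains.\<close>

lemma ev_kernels:
  assumes "is \<in> alternating I"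
    and a: "\<And>k. k < length is \<Longrightarrow> a k \<in> carrier (alg (P (is ! k)))"
    and zero: "\<And>k. k < length is \<Longrightarrow> position_functional base P is k (a k) = 0"
  shows "ev (map (\<lambda>k. (is ! k, a k)) [0..<length is]) [] = 0"
proof -
  let ?n = "length is"
  let ?w = "\<lambda>m. map (\<lambda>k. (is ! k, a k)) [m..<?n]"
  have I: "is ! k \<in> I" if "k < ?n" for k
    using assms(1) that by (auto simp: alternating_def)
  have adj: "is ! (k - 1) \<noteq> is ! k" if "0 < k" "k < ?n" for k
    using assms(1) that distinct_adj_nth[of "is" "k - 1"] by (simp add: alternating_def)
  have W: "?w m \<in> lists X" for m
    using I a by auto
  have Cons: "?w m = (is ! m, a m) # ?w (Suc m)" if "m < ?n" for m
    using that by (simp add: upt_conv_Cons)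
  \<comment> \<open>Only the comparison of the top index with the next letter matters, so a monotone letter may
    be dropped from the word as well as pushed on the stack.\<close>
  have "ev (?w m) S = 0"
    if "0 < m" "m \<le> ?n" "S \<noteq> []" "m < ?n \<Longrightarrow> fst (hd S) \<noteq> is ! m"
      "m < ?n \<Longrightarrow> fst (hd S) < is ! m \<longleftrightarrow> is ! (m - 1) < is ! m" for m S
    using that
  proof (induction "?n - m" arbitrary: m S)
    case 0
    then show ?case by simp
  next
    case (Suc d)
    then have m: "m < ?n" by simp
    let ?c = "chi S (is ! m) (a m)"
    have "ev (?w (Suc m)) ((is ! m, center (is ! m) ?c (a m)) # S) = 0"
      using Suc.hyps(2) Suc.prems m adj[of "Suc m"] by (intro Suc.hyps(1)) auto
    moreover have "?c * ev (?w (Suc m)) S = 0"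
    proof (cases "m \<in> Peak is \<or> m \<in> Bot is")
      case True
      \<comment> \<open>By the invariant the stack top compares with \<open>is ! m\<close> as the
        left neighbour in the word does, so the stack uses \<open>psi\<close> at a peak and
        \<open>theta\<close> at a bottom.\<close>
      then have "?c = 0"
        using zero[OF m] Suc.prems m
        by (cases S) (auto simp: position_functional_def stack_functional_def Peak_def Bot_def split: if_splits)
      then show ?thesis by simp
    next
      case False
      \<comment> \<open>Either \<open>m\<close> is the last letter and the nonempty stack gives 0,
        or the word is monotone at \<open>m\<close> and transitivity hands the invariant on to the
        next letter.\<close>
      have "ev (?w (Suc m)) S = 0"
        using Suc.hyps(2) Suc.prems m adj[of m] adj[of "Suc m"] False
        by (intro Suc.hyps(1)) (auto simp: Peak_def Bot_def)
      then show ?thesis by simp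
    qed
    ultimately show ?case
      using m pop_idem[of S "is ! m" "a m"] Suc.prems by (simp add: Cons ev_Cons push_def)
  qed
  note tail = this
  have n: "0 < ?n" using assms(1) by (simp add: alternating_def)
  have "ev (?w 0) [] = push (?w (Suc 0)) [] (is ! 0) (a 0)"
    using n by (simp add: Cons ev_Cons pop_def merge_def)
  also have "\<dots> = 0"
  proof -
    have "ev (?w (Suc 0)) [(is ! 0, b)] = 0" for b
      by (rule tail) (use n adj[of "Suc 0"] in \<open>auto simp: Suc_le_eq\<close>)
    then show ?thesis
      using n zero[of 0] by (simp add: push_def stack_functional_def position_functional_def)
  qed
  finally show ?thesis by simp
qed

lemma ex_vanishing_functional:
  obtains f where "f \<in> extensional (carrier FP)" "unital_functional FP f" "vanishes_on_kernels base I P f"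
proof -
  obtain f where f: "unital_functional FP f" "\<And>w. w \<in> lists X \<Longrightarrow> f (word w) = ev w []"
    by (rule ex_functional) (rule that)
  interpret FP: complex_algebra FP by (rule complex_algebra_free_product)
  interpret FP: ring FP by (rule free_product_ring)
  let ?g = "restrict f (carrier FP)"
  have "unital_functional FP ?g"
    using f(1) by (simp add: unital_functional_def)
  moreover have "vanishes_on_kernels base I P ?g"
    unfolding vanishes_on_kernels_def
  proof (intro ballI allI impI)
    fix "is" :: "'i list" and a
    assume alt: "is \<in> alternating I" and a: "\<forall>k<length is. a k \<in> carrier (alg (P (is ! k))) \<and>
      position_functional base P is k (a k) = 0"
    let ?w = "map (\<lambda>k. (is ! k, a k)) [0..<length is]"
    have w: "?w \<in> lists X"
      using alt a by (auto simp: alternating_def subset_iff)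
    then show "?g (word_product I (\<lambda>i. alg (P i)) is a) = 0"
      using ev_kernels[OF alt] a f(2)[OF w] word_closed[OF w] by (simp add: word_product_eq)
  qed
  ultimately show ?thesis using that[of ?g] by simp
qed

text \<open>The hypotheses speak of centered words instead of the kernel conditions, because that is
  what the block decomposition delivers for the functional pulled back from the iterated
  product.\<close>

lemma vanishing_functional_unique:
  assumes "unital_functional FP f" "unital_functional FP g"
    and "\<And>S. ok S \<Longrightarrow> S \<noteq> [] \<Longrightarrow> f (word (rev S)) = 0"
    and "\<And>S. ok S \<Longrightarrow> S \<noteq> [] \<Longrightarrow> g (word (rev S)) = 0"
    and "x \<in> carrier FP"
  shows "f x = g x"
proof (rule free_product_linear_eqI[OF _ _ module_complex_module _ assms(5)])
  show "f (word w) = g (word w)" if "w \<in> lists X" for w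
    using functional_eq_ev[OF assms(1,3) that] functional_eq_ev[OF assms(2,4) that] by simp
qed (use assms in \<open>auto simp: unital_functional_iff_linear\<close>)

lemma vanishing_functional_extensional_unique:
  assumes "unital_functional FP f" "unital_functional FP g"
    and "vanishes_on_kernels base I P f" "vanishes_on_kernels base I P g"
    and "f \<in> extensional (carrier FP)" "g \<in> extensional (carrier FP)"
  shows "f = g"
  using assms(5,6) vanishing_functional_unique[OF assms(1,2)] vanishes_on_stacks assms(3,4)
  by (blast intro: extensionalityI)

end

text \<open>Makes the definite description usable. The conditions on the three components do not
  interact, so three instances of \<open>space_family\<close>, differing in the functional at the
  bottom of the stack, settle them one by one.\<close>

lemma is_alpha_free_product:
  assumes "\<And>i. i \<in> I \<Longrightarrow> unital_prob_space3 (P i)"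
  shows "is_alpha_free_product I P (alpha_free_product I P)"
proof -
  interpret phi: space_family I P phi using assms by (simp add: space_family_def)
  interpret psi: space_family I P psi using assms by (simp add: space_family_def)
  interpret theta: space_family I P theta using assms by (simp add: space_family_def)
  obtain f where "f \<in> extensional (carrier phi.FP)" "unital_functional phi.FP f" "vanishes_on_kernels phi I P f"
    by (rule phi.ex_vanishing_functional) (rule that)
  moreover obtain g where "g \<in> extensional (carrier phi.FP)" "unital_functional phi.FP g" "vanishes_on_kernels psi I P g"
    by (rule psi.ex_vanishing_functional) (rule that)
  moreover obtain h where "h \<in> extensional (carrier phi.FP)" "unital_functional phi.FP h" "vanishes_on_kernels theta I P h"
    by (rule theta.ex_vanishing_functional) (rule that)
  ultimately have "is_alpha_free_product I P \<lparr>alg = phi.FP, phi = f, psi = g, theta = h\<rparr>"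
    by (simp add: is_alpha_free_product_def)
  moreover have "Q = Q'" if "is_alpha_free_product I P Q" "is_alpha_free_product I P Q'" for Q Q'
  proof (rule prob_space3.equality)
    show "alg Q = alg Q'" using that by (simp add: is_alpha_free_product_def)
    show "phi Q = phi Q'" "psi Q = psi Q'" "theta Q = theta Q'"
      using that phi.vanishing_functional_extensional_unique psi.vanishing_functional_extensional_unique
        theta.vanishing_functional_extensional_unique
      by (auto simp: is_alpha_free_product_def)
  qed simp
  ultimately show ?thesis
    unfolding alpha_free_product_def by (metis (mono_tags) theI)
qed

lemma is_alpha_free_productD:
  assumes "is_alpha_free_product I P Q"
  shows "alg Q = free_product I (\<lambda>i. alg (P i))"
    and "unital_functional (free_product I (\<lambda>i. alg (P i))) (phi Q)"
    and "unital_functional (free_product I (\<lambda>i. alg (P i))) (psi Q)"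
    and "unital_functional (free_product I (\<lambda>i. alg (P i))) (theta Q)"
    and "vanishes_on_kernels phi I P (phi Q)"
    and "vanishes_on_kernels psi I P (psi Q)"
    and "vanishes_on_kernels theta I P (theta Q)"
proof -
  show alg: "alg Q = free_product I (\<lambda>i. alg (P i))"
    using assms unfolding is_alpha_free_product_def by blast
  show "unital_functional (free_product I (\<lambda>i. alg (P i))) (phi Q)"
    "unital_functional (free_product I (\<lambda>i. alg (P i))) (psi Q)"
    "unital_functional (free_product I (\<lambda>i. alg (P i))) (theta Q)"
    unfolding alg[symmetric] using assms unfolding is_alpha_free_product_def by blast+
  show "vanishes_on_kernels phi I P (phi Q)" "vanishes_on_kernels psi I P (psi Q)"
    "vanishes_on_kernels theta I P (theta Q)"
    using assms unfolding is_alpha_free_product_def by blast+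
qed

text \<open>Allows the product to be iterated: its result is again an admissible factor.\<close>

lemma unital_alpha_free_product:
  assumes "\<And>i. i \<in> I \<Longrightarrow> unital_prob_space3 (P i)"
  shows "unital_prob_space3 (alpha_free_product I P)"
proof -
  interpret algebra_family I "\<lambda>i. alg (P i)"
    using assms by (simp add: algebra_family_def unital_prob_space3_def)
  show ?thesis
    using is_alpha_free_product[of I P] assms complex_algebra_free_product
    by (auto simp: is_alpha_free_product_def unital_prob_space3_def)
qed

section \<open>Associativity\<close>

declare One_nat_def [simp del]

text \<open>Maps in both directions come from the universal properties; both composites are compared
  with the identity on generators.\<close>

lemma ex_natural_identification:
  assumes "J \<inter> K = {}" and A: "\<And>i. i \<in> J \<union> K \<Longrightarrow> complex_algebra (A i)"
  shows "\<exists>h. natural_identification J K A h"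
proof -
  interpret J: algebra_family J A using A by (simp add: algebra_family_def)
  interpret K: algebra_family K A using A by (simp add: algebra_family_def)
  interpret I: algebra_family "J \<union> K" A using A by (simp add: algebra_family_def)
  define AA where "AA = pair_family J.FP K.FP"
  have AA: "AA 1 = J.FP" "AA 2 = K.FP" by (simp_all add: AA_def pair_family_def)
  interpret D: algebra_family "{1, 2}" AA
    using AA J.complex_algebra_free_product K.complex_algebra_free_product
    by (auto simp: algebra_family_def)
  have Dinc: "D.inc 1 \<in> algebra_hom J.FP D.FP" "D.inc 2 \<in> algebra_hom K.FP D.FP"
    using D.inc_hom[of 1] D.inc_hom[of 2] by (simp_all add: AA)
  define g where "g i a = (if i \<in> J then D.inc 1 (J.inc i a) else D.inc 2 (K.inc i a))" for i a
  have g: "g i \<in> algebra_hom (A i) D.FP" if "i \<in> J \<union> K" for i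
  proof (cases "i \<in> J")
    case True
    then have "g i = (\<lambda>a. D.inc 1 (J.inc i a))" by (simp add: g_def[abs_def])
    with True show ?thesis using algebra_hom_compose[OF J.inc_hom Dinc(1), of i] by simp
  next
    case False
    then have "g i = (\<lambda>a. D.inc 2 (K.inc i a))" by (simp add: g_def[abs_def])
    with False that show ?thesis using algebra_hom_compose[OF K.inc_hom Dinc(2), of i] by simp
  qed
  obtain h where h: "h \<in> algebra_hom I.FP D.FP"
    and hg: "\<And>i a. i \<in> J \<union> K \<Longrightarrow> a \<in> carrier (A i) \<Longrightarrow> h (I.inc i a) = g i a"
    by (rule I.free_product_hom[OF D.complex_algebra_free_product g]) (assumption, rule that)
  obtain hJ where hJ: "hJ \<in> algebra_hom J.FP I.FP"
    and hJg: "\<And>i a. i \<in> J \<Longrightarrow> a \<in> carrier (A i) \<Longrightarrow> hJ (J.inc i a) = I.inc i a"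
    by (rule J.free_product_hom[OF I.complex_algebra_free_product I.inc_hom]) (simp, rule that)
  obtain hK where hK: "hK \<in> algebra_hom K.FP I.FP"
    and hKg: "\<And>i a. i \<in> K \<Longrightarrow> a \<in> carrier (A i) \<Longrightarrow> hK (K.inc i a) = I.inc i a"
    by (rule K.free_product_hom[OF I.complex_algebra_free_product I.inc_hom]) (simp, rule that)
  define g' where "g' n = (if n = 1 then hJ else hK)" for n :: nat
  have g': "g' n \<in> algebra_hom (AA n) I.FP" if "n \<in> {1, 2}" for n
    using that hJ hK by (auto simp: g'_def AA)
  obtain h' where h': "h' \<in> algebra_hom D.FP I.FP"
    and h'g: "\<And>n x. n \<in> {1, 2} \<Longrightarrow> x \<in> carrier (AA n) \<Longrightarrow> h' (D.inc n x) = g' n x"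
    by (rule D.free_product_hom[OF I.complex_algebra_free_product g']) (assumption, rule that)
  have J_inc: "J.inc j a \<in> carrier J.FP" if "j \<in> J" "a \<in> carrier (A j)" for j a
    using that by (rule algebra_homD(1)[OF J.inc_hom])
  have K_inc: "K.inc k a \<in> carrier K.FP" if "k \<in> K" "a \<in> carrier (A k)" for k a
    using that by (rule algebra_homD(1)[OF K.inc_hom])
  have id: "(\<lambda>x. x) \<in> algebra_hom B B" for B :: "(complex, 'z) module"
    by (rule algebra_homI) auto
  have left: "h' (h x) = x" if "x \<in> carrier I.FP" for x
  proof (rule I.free_product_hom_eqI[OF I.complex_algebra_free_product algebra_hom_compose[OF h h'] id _ that])
    fix i a assume i: "i \<in> J \<union> K" and a: "a \<in> carrier (A i)"
    show "h' (h (I.inc i a)) = I.inc i a"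
    proof (cases "i \<in> J")
      case True
      then show ?thesis
        using hg[OF i a] h'g[of 1 "J.inc i a"] hJg[of i a] J_inc[of i a] a by (simp add: g_def g'_def AA)
    next
      case False
      then show ?thesis
        using hg[OF i a] h'g[of 2 "K.inc i a"] hKg[of i a] K_inc[of i a] a i by (simp add: g_def g'_def AA)
    qed
  qed
  \<comment> \<open>Generators of the outer free product are arbitrary elements of the two factors,
    not only images of the \<open>A i\<close>. Hence \<open>h\<close> after \<open>hJ\<close> has to
    be recognised as the inclusion of the whole factor, and likewise for \<open>hK\<close>.\<close>
  have J: "h (hJ x) = D.inc 1 x" if "x \<in> carrier J.FP" for x
    using hJg hg that
    by (intro J.free_product_hom_eqI[OF D.complex_algebra_free_product algebra_hom_compose[OF hJ h] Dinc(1) _ that])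
      (simp add: g_def)
  have K: "h (hK x) = D.inc 2 x" if "x \<in> carrier K.FP" for x
    using hKg hg that assms(1)
    by (intro K.free_product_hom_eqI[OF D.complex_algebra_free_product algebra_hom_compose[OF hK h] Dinc(2) _ that])
      (auto simp: g_def)
  have right: "h (h' y) = y" if "y \<in> carrier D.FP" for y
  proof (rule D.free_product_hom_eqI[OF D.complex_algebra_free_product algebra_hom_compose[OF h' h] id _ that])
    fix n x assume "n \<in> {1::nat, 2}" "x \<in> carrier (AA n)"
    then show "h (h' (D.inc n x)) = D.inc n x"
      using h'g[of n x] J[of x] K[of x] by (auto simp: g'_def AA)
  qed
  have "bij_betw h (carrier I.FP) (carrier D.FP)"
    by (rule bij_betw_byWitness[of _ h'])
      (use left right algebra_homD(1)[OF h] algebra_homD(1)[OF h'] in auto)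
  then have "natural_identification J K A h"
    using h hg assms(1) unfolding natural_identification_def Let_def AA_def[symmetric]
    by (auto simp: algebra_iso_def g_def)
  then show ?thesis by blast
qed

section \<open>Blocks of a word along an ordered decomposition of the index set\<close>

locale ordered_split =
  fixes J K :: "'i::linorder set" and P :: "'i \<Rightarrow> 'a prob_space3" and h
  assumes disjoint: "J \<inter> K = {}"
    and less: "\<And>j k. j \<in> J \<Longrightarrow> k \<in> K \<Longrightarrow> j < k"
    and space: "\<And>i. i \<in> J \<union> K \<Longrightarrow> unital_prob_space3 (P i)"
    and identification: "natural_identification J K (\<lambda>i. alg (P i)) h"
begin

sublocale I: algebra_family "J \<union> K" "\<lambda>i. alg (P i)"
  using space by (simp add: algebra_family_def unital_prob_space3_def)

sublocale J: algebra_family J "\<lambda>i. alg (P i)"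
  using space by (simp add: algebra_family_def unital_prob_space3_def)

sublocale K: algebra_family K "\<lambda>i. alg (P i)"
  using space by (simp add: algebra_family_def unital_prob_space3_def)

definition factor :: "nat \<Rightarrow> (('i \<times> 'a) list \<Rightarrow> complex) set prob_space3" where
  "factor = pair_family (alpha_free_product J P) (alpha_free_product K P)"

lemma factor_simps: "factor 1 = alpha_free_product J P" "factor 2 = alpha_free_product K P"
  by (simp_all add: factor_def pair_family_def)

lemma is_alpha_free_product_factors:
  "is_alpha_free_product J P (factor 1)" "is_alpha_free_product K P (factor 2)"
  unfolding factor_simps by (rule is_alpha_free_product, simp add: space)+

lemma alg_factor: "alg (factor 1) = J.FP" "alg (factor 2) = K.FP"
  using is_alpha_free_product_factors by (simp_all add: is_alpha_free_product_def)

lemma space_factor: "n \<in> {1, 2} \<Longrightarrow> unital_prob_space3 (factor n)"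
  using unital_alpha_free_product[of J P] unital_alpha_free_product[of K P] space
  by (auto simp: factor_simps)

sublocale D: algebra_family "{1, 2}" "\<lambda>n. alg (factor n)"
  using space_factor by (simp add: algebra_family_def unital_prob_space3_def)

lemma identification_hom: "h \<in> algebra_iso I.FP D.FP"
  and identification_inc:
    "\<And>j a. j \<in> J \<Longrightarrow> a \<in> carrier (alg (P j)) \<Longrightarrow> h (I.inc j a) = D.inc 1 (J.inc j a)"
    "\<And>k a. k \<in> K \<Longrightarrow> a \<in> carrier (alg (P k)) \<Longrightarrow> h (I.inc k a) = D.inc 2 (K.inc k a)"
proof -
  have "pair_family J.FP K.FP = (\<lambda>n. alg (factor n))"
    using alg_factor by (auto simp: pair_family_def factor_def)
  then show "h \<in> algebra_iso I.FP D.FP"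
    "\<And>j a. j \<in> J \<Longrightarrow> a \<in> carrier (alg (P j)) \<Longrightarrow> h (I.inc j a) = D.inc 1 (J.inc j a)"
    "\<And>k a. k \<in> K \<Longrightarrow> a \<in> carrier (alg (P k)) \<Longrightarrow> h (I.inc k a) = D.inc 2 (K.inc k a)"
    using identification by (simp_all add: natural_identification_def Let_def)
qed

definition side :: "'i \<Rightarrow> nat" where
  "side i = (if i \<in> J then 1 else 2)"

definition part :: "nat \<Rightarrow> 'i set" where
  "part s = (if s = 1 then J else K)"

text \<open>Being an element of the factor with index \<open>s\<close>, a block can serve as a
  single letter of the outer product. Like every stack, \<open>U\<close> has its last letter at the
  head.\<close>

definition block :: "nat \<Rightarrow> ('i \<times> 'a) list \<Rightarrow> (('i \<times> 'a) list \<Rightarrow> complex) set" where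
  "block s U = (if s = 1 then J.word (rev U) else K.word (rev U))"

lemma part_side: "i \<in> J \<union> K \<Longrightarrow> i \<in> part (side i)"
  by (auto simp: part_def side_def)

lemma side_in: "side i \<in> {1, 2}"
  by (auto simp: side_def)

lemma block_closed:
  assumes "s \<in> {1, 2}" "stack_ok base (part s) P U" "base \<in> {phi, psi, theta}"
  shows "block s U \<in> carrier (alg (factor s))"
proof -
  interpret B: space_family "part s" P base
    using assms space by (auto simp: space_family_def part_def)
  have U: "rev U \<in> lists B.X" using B.ok_lists[OF assms(2)] by auto
  show ?thesis
  proof (cases "s = 1")
    case True
    with U have "rev U \<in> lists J.X" by (simp add: part_def)
    from J.word_closed[OF this] True show ?thesis by (simp add: block_def alg_factor)
  next
    case False
    with U have "rev U \<in> lists K.X" by (simp add: part_def)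
    from K.word_closed[OF this] False assms(1) show ?thesis by (simp add: block_def alg_factor)
  qed
qed

lemma identification_letter:
  assumes "i \<in> J \<union> K" "a \<in> carrier (alg (P i))"
  shows "h (I.letter (i, a)) = D.letter (side i, block (side i) [(i, a)])"
  using assms disjoint identification_inc[of i a] J.word_singleton[of "(i, a)"] K.word_singleton[of "(i, a)"]
  by (auto simp: I.letter_def J.letter_def K.letter_def D.letter_def block_def side_def)

lemma block_singleton_closed:
  assumes "i \<in> J \<union> K" "a \<in> carrier (alg (P i))"
  shows "block (side i) [(i, a)] \<in> carrier (alg (factor (side i)))"
  using assms J.word_closed[of "[(i, a)]"] K.word_closed[of "[(i, a)]"]
  by (auto simp: block_def side_def alg_factor)

lemma block_append:
  assumes "s \<in> {1, 2}" "stack_ok base (part s) P U" "base \<in> {phi, psi, theta}"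
    and "i \<in> part s" "a \<in> carrier (alg (P i))"
  shows "block s ((i, a) # U) = block s U \<otimes>\<^bsub>alg (factor s)\<^esub> block s [(i, a)]"
proof -
  interpret B: space_family "part s" P base
    using assms space by (auto simp: space_family_def part_def)
  have U: "rev U \<in> lists B.X" using B.ok_lists[OF assms(2)] by auto
  show ?thesis
  proof (cases "s = 1")
    case True
    with U assms(4,5) have "rev U \<in> lists J.X" "[(i, a)] \<in> lists J.X" by (simp_all add: part_def)
    from J.word_append[OF this] True show ?thesis by (simp add: block_def alg_factor)
  next
    case False
    with U assms(4,5) have "rev U \<in> lists K.X" "[(i, a)] \<in> lists K.X" by (simp_all add: part_def)
    from K.word_append[OF this] False assms(1) show ?thesis by (simp add: block_def alg_factor)
  qed
qed

text \<open>A centered word over \<^term>\<open>J \<union> K\<close> is cut into maximal blocks over \<^term>\<open>J\<close> and over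
  \<^term>\<open>K\<close>. A block over \<^term>\<open>K\<close> that is not the first one is entered by an ascent and one over
  \<^term>\<open>J\<close> by a descent, so its first letter is centered for \<^const>\<open>psi\<close> or \<^const>\<open>theta\<close>,
  which makes the whole block a centered letter of the two-factor product.\<close>

lemma stack_blocks:
  fixes base :: "'a prob_space3 \<Rightarrow> 'a \<Rightarrow> complex"
    and base' :: "(('i \<times> 'a) list \<Rightarrow> complex) set prob_space3 \<Rightarrow> (('i \<times> 'a) list \<Rightarrow> complex) set \<Rightarrow> complex"
  assumes base: "base \<in> {phi, psi, theta}"
    and vanish_base: "\<And>s U. \<lbrakk>s \<in> {1, 2}; stack_ok base (part s) P U; U \<noteq> []\<rbrakk> \<Longrightarrow>
      base' (factor s) (block s U) = 0"
    and vanish_psi: "\<And>U. \<lbrakk>stack_ok psi K P U; U \<noteq> []\<rbrakk> \<Longrightarrow> psi (factor 2) (block 2 U) = 0"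
    and vanish_theta: "\<And>U. \<lbrakk>stack_ok theta J P U; U \<noteq> []\<rbrakk> \<Longrightarrow> theta (factor 1) (block 1 U) = 0"
    and "stack_ok base (J \<union> K) P S" "S \<noteq> []"
  shows "\<exists>T. T \<noteq> [] \<and> stack_ok base' {1, 2} factor T \<and> h (I.word (rev S)) = D.word (rev T)"
proof -
  \<comment> \<open>The functional for which the lowest letter of a block lying over
    \<open>T\<close> is centered; index 1 over a nonempty \<open>T\<close> means a descent from
    \<open>K\<close> into \<open>J\<close>, index 2 an ascent.\<close>
  define entry :: "nat \<Rightarrow> (nat \<times> (('i \<times> 'a) list \<Rightarrow> complex) set) list \<Rightarrow> 'a prob_space3 \<Rightarrow> 'a \<Rightarrow> complex"
    where "entry s T = (if T = [] then base else if s = 1 then theta else psi)" for s T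
  interpret IB: space_family "J \<union> K" P base using base space by (simp add: space_family_def)
  have entry: "entry s T \<in> {phi, psi, theta}" for s T
    using base by (auto simp: entry_def)
  \<comment> \<open>The outer stack compares 1 with 2 just as the letters compare across the cut, so
    it asks for \<open>theta\<close> on a \<open>J\<close>-block and \<open>psi\<close> on a
    \<open>K\<close>-block. Both vanish on the block because its lowest letter is centered for the
    same functional.\<close>
  have ok_block: "stack_ok base' {1, 2} factor ((s, block s U) # T)"
    if "s \<in> {1, 2}" "stack_ok (entry s T) (part s) P U" "U \<noteq> []"
      "T \<noteq> [] \<longrightarrow> fst (hd T) \<noteq> s" "stack_ok base' {1, 2} factor T" for s U T
  proof -
    have "stack_functional base' factor T s (block s U) = 0"
    proof (cases T)
      case Nil
      then show ?thesis
        using vanish_base that by (simp add: stack_functional_def entry_def)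
    next
      case (Cons x T')
      then have "fst x \<in> {1, 2}" "fst x \<noteq> s" using that by auto
      then show ?thesis
        using vanish_psi[of U] vanish_theta[of U] that Cons
        by (auto simp: stack_functional_def entry_def part_def)
    qed
    then show ?thesis
      using that block_closed[OF that(1,2) entry] by simp
  qed
  \<comment> \<open>The top block \<open>U\<close> is kept open as a list of letters, since the next
    letter may still belong to it; only the blocks in \<open>T\<close> are closed. Its top index is
    that of \<open>S\<close>, so within the same part the next letter meets the same functional over
    \<open>U\<close> as over \<open>S\<close>.\<close>
  have "\<exists>U T. let s = side (fst (hd S)) in
      U \<noteq> [] \<and> fst (hd U) = fst (hd S) \<and> stack_ok (entry s T) (part s) P U \<and>
      (T \<noteq> [] \<longrightarrow> fst (hd T) \<noteq> s) \<and> stack_ok base' {1, 2} factor T \<and>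
      h (I.word (rev S)) = D.word (rev T @ [(s, block s U)])"
    using assms(5,6)
  proof (induction S)
    case Nil
    then show ?case by simp
  next
    case (Cons x S)
    obtain i a where x: "x = (i, a)" by fastforce
    let ?s = "side i"
    have i: "i \<in> J \<union> K" "a \<in> carrier (alg (P i))" "stack_ok base (J \<union> K) P S"
      and chi: "stack_functional base P S i a = 0"
      using Cons.prems by (auto simp: x)
    have h: "h \<in> algebra_hom I.FP D.FP"
      using identification_hom by (simp add: algebra_iso_def)
    have single: "stack_ok b (part ?s) P [(i, a)]" if "b (P i) a = 0" for b
      using i that part_side by (simp add: stack_functional_def)
    show ?case
    proof (cases "S = []")
      case True
      then have ok1: "stack_ok base (part ?s) P [(i, a)]"
        using chi by (intro single) (simp add: stack_functional_def)
      have "h (I.word [(i, a)]) = D.word [(?s, block ?s [(i, a)])]"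
        using i identification_letter[of i a] block_singleton_closed[of i a] side_in[of i]
        by (simp add: I.word_singleton D.word_singleton)
      then show ?thesis
        using True ok1 x by (intro exI[of _ "[(i, a)]"] exI[of _ "[]"]) (simp add: Let_def entry_def)
    next
      case False
      let ?t = "side (fst (hd S))"
      obtain U T where U: "U \<noteq> []" "fst (hd U) = fst (hd S)" "stack_ok (entry ?t T) (part ?t) P U"
        and T: "T \<noteq> [] \<longrightarrow> fst (hd T) \<noteq> ?t" "stack_ok base' {1, 2} factor T"
        and word: "h (I.word (rev S)) = D.word (rev T @ [(?t, block ?t U)])"
        using Cons.IH[OF i(3) False] by (auto simp: Let_def)
      have D_T: "rev T \<in> lists D.X"
        using T(2) by (induction T) (auto simp: free_product_gens_def mem_Times_iff)
      have bU: "block ?t U \<in> carrier (alg (factor ?t))"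
        by (rule block_closed[OF side_in U(3) entry])
      have ba: "block ?s [(i, a)] \<in> carrier (alg (factor ?s))"
        by (rule block_singleton_closed[OF i(1,2)])
      have S_lists: "rev S \<in> lists I.X"
        using IB.ok_lists[OF i(3)] by auto
      have "h (I.word (rev (x # S))) = h (I.word (rev S)) \<otimes>\<^bsub>D.FP\<^esub> h (I.letter (i, a))"
        using S_lists i algebra_homD(3)[OF h] I.word_closed[OF S_lists] I.letter_closed[of "(i, a)"]
        by (simp add: x I.word_append I.word_singleton)
      also have "\<dots> = D.word (rev T @ [(?t, block ?t U)]) \<otimes>\<^bsub>D.FP\<^esub> D.word [(?s, block ?s [(i, a)])]"
        using i ba side_in[of i] by (simp add: word identification_letter D.word_singleton)
      also have "\<dots> = D.word (rev T @ [(?t, block ?t U), (?s, block ?s [(i, a)])])"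
        using D_T bU ba side_in[of i] side_in[of "fst (hd S)"] by (simp add: D.word_append[symmetric])
      finally have word': "h (I.word (rev (x # S))) =
        D.word (rev T @ [(?t, block ?t U), (?s, block ?s [(i, a)])])" .
      show ?thesis
      proof (cases "?s = ?t")
        case True
        have "stack_functional (entry ?t T) P U i = stack_functional base P S i"
          using U(1,2) False by (cases U; cases S) (simp_all add: stack_functional_def)
        then have "stack_ok (entry ?s T) (part ?s) P ((i, a) # U)"
          using U i chi True part_side[OF i(1)] Cons.prems False x by auto
        \<comment> \<open>Two outer letters with the same index multiply inside their factor, and
          their product is the longer block.\<close>
        moreover have "D.word (rev T @ [(?t, block ?t U), (?s, block ?s [(i, a)])]) =
            D.word (rev T @ [(?s, block ?s ((i, a) # U))])"
          using D.word_mult[OF D_T _ side_in bU, of "[]" "block ?s [(i, a)]"] ba True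
            block_append[OF side_in U(3) entry _ i(2)] part_side[OF i(1)]
          by simp
        ultimately show ?thesis
          using True T word' x by (intro exI[of _ "(i, a) # U"] exI[of _ T]) (simp add: Let_def)
      next
        case diff: False
        \<comment> \<open>By \<open>less\<close>, a change of side is an ascent into
          \<open>K\<close> or a descent into \<open>J\<close>, so the functional centering the
          letter over \<open>S\<close> is the one that opens the new block.\<close>
        have "entry ?s ((?t, block ?t U) # T) (P i) a = 0"
        proof (cases S)
          case (Cons y S')
          then have y: "fst y \<in> J \<union> K" using i(3) by simp
          show ?thesis
          proof (cases "i \<in> J")
            case True
            with diff y Cons have "fst y \<in> K" by (auto simp: side_def split: if_splits)
            then have "\<not> fst y < i" using less[OF True] by (blast dest: less_not_sym)
            with chi Cons True show ?thesis
              by (simp add: entry_def side_def stack_functional_def)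
          next
            case iK: False
            with diff y Cons have "fst y \<in> J" by (auto simp: side_def split: if_splits)
            with less[OF this, of i] chi Cons iK i(1) show ?thesis
              by (auto simp: entry_def side_def stack_functional_def)
          qed
        qed (use False in simp)
        then have "stack_ok (entry ?s ((?t, block ?t U) # T)) (part ?s) P [(i, a)]"
          by (rule single)
        moreover have "stack_ok base' {1, 2} factor ((?t, block ?t U) # T)"
          by (rule ok_block[OF side_in U(3,1) T])
        ultimately show ?thesis
          using diff word' x
          by (intro exI[of _ "[(i, a)]"] exI[of _ "(?t, block ?t U) # T"]) (simp add: Let_def)
      qed
    qed
  qed
  then obtain U T where "U \<noteq> []" "stack_ok (entry (side (fst (hd S))) T) (part (side (fst (hd S)))) P U"
    "T \<noteq> [] \<longrightarrow> fst (hd T) \<noteq> side (fst (hd S))" "stack_ok base' {1, 2} factor T"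
    and word: "h (I.word (rev S)) = D.word (rev T @ [(side (fst (hd S)), block (side (fst (hd S))) U)])"
    by (auto simp: Let_def)
  then have "stack_ok base' {1, 2} factor ((side (fst (hd S)), block (side (fst (hd S))) U) # T)"
    by (intro ok_block[OF side_in])
  with word show ?thesis
    by (intro exI[of _ "(side (fst (hd S)), block (side (fst (hd S))) U) # T"]) simp
qed

text \<open>\<open>base\<close> and \<open>base'\<close> stand for one selector at two types, that
  of the given spaces and that of the factors. A fixed variable has only one type, so two are used,
  linked by the hypotheses on the factors.\<close>

lemma functional_eq:
  assumes base: "base \<in> {phi, psi, theta}" and base': "base' \<in> {phi, psi, theta}"
    and J: "vanishes_on_kernels base J P (base' (factor 1))"
    and K: "vanishes_on_kernels base K P (base' (factor 2))"
    and f: "unital_functional I.FP f" "vanishes_on_kernels base (J \<union> K) P f"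
    and g: "unital_functional D.FP g" "vanishes_on_kernels base' {1, 2} factor g"
    and "x \<in> carrier I.FP"
  shows "f x = g (h x)"
proof -
  interpret IB: space_family "J \<union> K" P base using base space by (simp add: space_family_def)
  interpret JB: space_family J P base using base space by (simp add: space_family_def)
  interpret KB: space_family K P base using base space by (simp add: space_family_def)
  interpret DB: space_family "{1, 2}" factor base' using base' space_factor by (simp add: space_family_def)
  interpret JT: space_family J P theta using space by (simp add: space_family_def)
  interpret KP: space_family K P psi using space by (simp add: space_family_def)
  have h: "h \<in> algebra_hom I.FP D.FP"
    using identification_hom by (simp add: algebra_iso_def)
  have factors: "vanishes_on_kernels psi K P (psi (factor 2))" "vanishes_on_kernels theta J P (theta (factor 1))"
    using is_alpha_free_product_factors by (simp_all add: is_alpha_free_product_def)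
  show ?thesis
  proof (rule IB.vanishing_functional_unique[OF f(1) _ _ _ assms(9), where g = "\<lambda>x. g (h x)"])
    show "unital_functional I.FP (\<lambda>x. g (h x))"
      using g(1) linear_maps_compose[OF algebra_hom_linear[OF h], of g complex_module] algebra_homD(5)[OF h]
      by (simp add: unital_functional_iff_linear)
    show "f (I.word (rev S)) = 0" if "IB.ok S" "S \<noteq> []" for S
      using IB.vanishes_on_stacks[OF f(2) that] .
    show "g (h (I.word (rev S))) = 0" if S: "IB.ok S" "S \<noteq> []" for S
    proof -
      \<comment> \<open>The first block vanishes by the hypotheses on \<open>base'\<close>; for all
        later blocks the \<open>psi\<close>-component over \<open>K\<close> and the
        \<open>theta\<close>-component over \<open>J\<close> are supplied.\<close>
      have "\<exists>T. T \<noteq> [] \<and> stack_ok base' {1, 2} factor T \<and> h (I.word (rev S)) = D.word (rev T)"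
      proof (rule stack_blocks[OF base _ _ _ S])
        show "base' (factor s) (block s U) = 0"
          if "s \<in> {1, 2}" "stack_ok base (part s) P U" "U \<noteq> []" for s U
          using that JB.vanishes_on_stacks[OF J, of U] KB.vanishes_on_stacks[OF K, of U]
          by (auto simp: block_def part_def)
        show "psi (factor 2) (block 2 U) = 0" if "stack_ok psi K P U" "U \<noteq> []" for U
          using KP.vanishes_on_stacks[OF factors(1) that] by (simp add: block_def)
        show "theta (factor 1) (block 1 U) = 0" if "stack_ok theta J P U" "U \<noteq> []" for U
          using JT.vanishes_on_stacks[OF factors(2) that] by (simp add: block_def)
      qed
      then show ?thesis
        using DB.vanishes_on_stacks[OF g(2)] by auto
    qed
  qed
qed

lemma equal_under_identification:
  "equal_under h (alpha_free_product (J \<union> K) P)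
    (alpha_free_times (alpha_free_product J P) (alpha_free_product K P))"
proof -
  let ?L = "alpha_free_product (J \<union> K) P" and ?R = "alpha_free_product {1, 2} factor"
  have L: "is_alpha_free_product (J \<union> K) P ?L"
    by (rule is_alpha_free_product) (rule space)
  have R: "is_alpha_free_product {1, 2} factor ?R"
    by (rule is_alpha_free_product) (rule space_factor)
  have algs: "alg ?L = I.FP" "alg ?R = D.FP"
    using L R by (simp_all add: is_alpha_free_product_def)
  note unital = is_alpha_free_productD(2-4)[OF L] is_alpha_free_productD(2-4)[OF R]
  note vanish = is_alpha_free_productD(5-7)[OF L] is_alpha_free_productD(5-7)[OF R]
    is_alpha_free_productD(5-7)[OF is_alpha_free_product_factors(1)]
    is_alpha_free_productD(5-7)[OF is_alpha_free_product_factors(2)]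
  have "phi ?L x = phi ?R (h x)" if "x \<in> carrier I.FP" for x
    by (rule functional_eq[of phi phi, OF _ _ vanish(7,10) unital(1) vanish(1) unital(4) vanish(4) that])
      simp_all
  moreover have "psi ?L x = psi ?R (h x)" if "x \<in> carrier I.FP" for x
    by (rule functional_eq[of psi psi, OF _ _ vanish(8,11) unital(2) vanish(2) unital(5) vanish(5) that])
      simp_all
  moreover have "theta ?L x = theta ?R (h x)" if "x \<in> carrier I.FP" for x
    by (rule functional_eq[of theta theta, OF _ _ vanish(9,12) unital(3) vanish(3) unital(6) vanish(6) that])
      simp_all
  ultimately have "equal_under h ?L ?R"
    using identification_hom by (simp add: equal_under_def algs)
  then show ?thesis
    by (simp add: alpha_free_times_def factor_def)
qed

end

theorem theorem2p13:
  fixes I J K :: "'i::linorder set"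
    and P :: "'i \<Rightarrow> 'a prob_space3"
  assumes "J \<noteq> {}" and "K \<noteq> {}" and "J \<inter> K = {}" and "I = J \<union> K"
    and "\<And>j k. j \<in> J \<Longrightarrow> k \<in> K \<Longrightarrow> j < k"
    and "\<And>i. i \<in> I \<Longrightarrow> unital_prob_space3 (P i)"
  shows "\<exists>h. natural_identification J K (\<lambda>i. alg (P i)) h \<and>
    equal_under h (alpha_free_product I P)
      (alpha_free_times (alpha_free_product J P) (alpha_free_product K P))"
proof -
  have "complex_algebra (alg (P i))" if "i \<in> J \<union> K" for i
    using that assms(4,6) by (simp add: unital_prob_space3_def)
  then obtain h where h: "natural_identification J K (\<lambda>i. alg (P i)) h"
    using ex_natural_identification[OF assms(3), of "\<lambda>i. alg (P i)"] by blast
  then interpret ordered_split J K P h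
    using assms by (simp add: ordered_split_def)
  from h equal_under_identification show ?thesis
    by (auto simp: assms(4))
qed

end
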